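(* Let $\Omega\subset\mathbb{C}^d$ be a complete Kobayashi hyperbolic domain that has the geodesic visibility property and satisfies: for every $\xi\in\partial\Omega$, any two geodesic rays $\gamma$ and $\sigma$ in $(\Omega,\mathsf{k}_\Omega)$ landing at $\xi$ are strongly asymptotic (with respect to $\mathsf{k}_\Omega$). Then the map $\Psi:\overline{\Omega}\to\overline{\Omega}^H$ defined by $$\Psi(\xi)=\begin{cases}[\mathsf{k}_\Omega(\,\cdot\,,\xi)], & \text{if } \xi\in\Omega,\\ [B_\gamma], & \text{if } \xi\in\partial\Omega \text{ and } \gamma \text{ is a geodesic ray in } (\Omega,\mathsf{k}_\Omega)\text{ landing at }\xi,\end{cases}$$ is well defined and embeds $\overline{\Omega}$ into $\overline{\Omega}^H$ (i.e., is a homeomorphism onto its image).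
   Context: $\mathsf{k}_\Omega$ denotes the Kobayashi distance of $\Omega$; $\Omega$ is complete Kobayashi hyperbolic if $\mathsf{k}_\Omega$ is a distance and $(\Omega,\mathsf{k}_\Omega)$ is complete (then it is a proper geodesic space). $\overline{\Omega}$ and $\partial\Omega$ are the Euclidean closure and boundary in $\mathbb{C}^d$ ($\Omega$ may be unbounded). A geodesic ray (resp. geodesic segment) in $(\Omega,\mathsf{k}_\Omega)$ is an isometric embedding of $[0,\infty)$ (resp. of some $[a,b]$, $a\le b$) into it. A geodesic ray $\gamma$ lands at $\xi\in\partial\Omega$ if $\lim_{t\to\infty}\gamma(t)=\xi$ in the Euclidean topology. Two geodesic rays $\gamma,\sigma$ are strongly asymptotic if there is $T\in\mathbb{R}$ with $\lim_{t\to\infty}\mathsf{k}_\Omega(\gamma(t),\sigma(t+T))=0$. Geodesic visibility property: for every two distinct points $p,q\in\partial\Omega$ there exist neighbourhoods $U_p$ of $p$ and $U_q$ of $q$ in $\mathbb{C}^d$ with $\overline{U_p}\cap\overline{U_q}=\emptyset$ and a compact set $K\subset\Omega$ such that every geodesic segment $\gamma:[a,b]\to\Omega$ of $(\Omega,\mathsf{k}_\Omega)$ with $\gamma(a)\in U_p$ and $\gamma(b)\in U_q$ intersects $K$. Horofunction compactification: for a locally compact distance space $(X,d)$, give $C(X,\mathbb{R})$ (continuous real functions) the topology of uniform convergence on compact sets, let $C_*(X,\mathbb{R})$ be its quotient (as a topological vector space) by the constant functions, and write $[f]$ for the class of $f$. Let $\tau:X\to C_*(X,\mathbb{R})$, $\tau(x)=[d(x,\cdot)]$.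 Then $\overline{X}^H$ is the closure of $\tau(X)$ in $C_*(X,\mathbb{R})$ (a compact set). $\overline{\Omega}^H$ denotes the horofunction compactification of $(\Omega,\mathsf{k}_\Omega)$. Busemann function: for a geodesic ray $\gamma$ in a proper geodesic space $(X,d)$, $B_\gamma(x,y)=\lim_{t\to\infty}\big(d(x,\gamma(t))-d(\gamma(t),y)\big)$ for $x,y\in X$ (the limit exists). The class $[B_\gamma(\cdot,y)]\in\overline{X}^H$ does not depend on $y$ and is denoted $[B_\gamma]$. *)

theory Defs
  imports "HOL-Analysis.Analysis"
begin

section \<open>The Kobayashi distance\<close>

text \<open>Curvature normalised to -4. All notions below that enter the theorem are invariant
  under rescaling the distance by a positive constant.\<close>

definition poincare_dist :: "complex \<Rightarrow> complex \<Rightarrow> real" where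
  "poincare_dist z w = artanh (cmod ((z - w) / (1 - cnj w * z)))"

definition analytic_disc :: "(complex ^ 'd) set \<Rightarrow> (complex \<Rightarrow> complex ^ 'd) \<Rightarrow> bool" where
  "analytic_disc \<Omega> f \<longleftrightarrow>
     (\<forall>j. (\<lambda>z. f z $ j) holomorphic_on ball 0 1) \<and> f ` ball 0 1 \<subseteq> \<Omega>"

definition kobayashi_chain :: "(complex ^ 'd) set \<Rightarrow> complex ^ 'd \<Rightarrow> complex ^ 'd \<Rightarrow> nat \<Rightarrow>
    (nat \<Rightarrow> complex \<Rightarrow> complex ^ 'd) \<Rightarrow> (nat \<Rightarrow> complex) \<Rightarrow> (nat \<Rightarrow> complex) \<Rightarrow> bool" where
  "kobayashi_chain \<Omega> x y n f a b \<longleftrightarrow>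
     (\<forall>i<n. analytic_disc \<Omega> (f i) \<and> a i \<in> ball 0 1 \<and> b i \<in> ball 0 1) \<and>
     (\<exists>p. p 0 = x \<and> p n = y \<and> (\<forall>i<n. f i (a i) = p i \<and> f i (b i) = p (Suc i)))"

text \<open>The value 0 off \<open>\<Omega>\<close> is a junk value; the locale \<^locale>\<open>Metric_space\<close> requires symmetry
  and nonnegativity of the distance function on the whole type. For \<open>\<Omega>\<close> open and connected
  the set of lengths is nonempty.\<close>

definition kobayashi :: "(complex ^ 'd) set \<Rightarrow> complex ^ 'd \<Rightarrow> complex ^ 'd \<Rightarrow> real" where
  "kobayashi \<Omega> x y =
     (if x \<in> \<Omega> \<and> y \<in> \<Omega>
      then Inf {\<Sum>i<n. poincare_dist (a i) (b i) | n f a b. kobayashi_chain \<Omega> x y n f a b}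
      else 0)"

definition complete_kobayashi_hyperbolic :: "(complex ^ 'd) set \<Rightarrow> bool" where
  "complete_kobayashi_hyperbolic \<Omega> \<longleftrightarrow>
     Metric_space \<Omega> (kobayashi \<Omega>) \<and> Metric_space.mcomplete \<Omega> (kobayashi \<Omega>)"


section \<open>Geodesics\<close>

definition geodesic_segment :: "'a set \<Rightarrow> ('a \<Rightarrow> 'a \<Rightarrow> real) \<Rightarrow> real \<Rightarrow> real \<Rightarrow> (real \<Rightarrow> 'a) \<Rightarrow> bool" where
  "geodesic_segment M d a b \<gamma> \<longleftrightarrow>
     a \<le> b \<and> \<gamma> ` {a..b} \<subseteq> M \<and> (\<forall>s\<in>{a..b}. \<forall>t\<in>{a..b}. d (\<gamma> s) (\<gamma> t) = \<bar>s - t\<bar>)"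

definition geodesic_ray :: "'a set \<Rightarrow> ('a \<Rightarrow> 'a \<Rightarrow> real) \<Rightarrow> (real \<Rightarrow> 'a) \<Rightarrow> bool" where
  "geodesic_ray M d \<gamma> \<longleftrightarrow>
     \<gamma> ` {0..} \<subseteq> M \<and> (\<forall>s\<in>{0..}. \<forall>t\<in>{0..}. d (\<gamma> s) (\<gamma> t) = \<bar>s - t\<bar>)"

definition lands_at :: "(real \<Rightarrow> 'a::topological_space) \<Rightarrow> 'a \<Rightarrow> bool" where
  "lands_at \<gamma> \<xi> \<longleftrightarrow> (\<gamma> \<longlongrightarrow> \<xi>) at_top"

definition strongly_asymptotic :: "('a \<Rightarrow> 'a \<Rightarrow> real) \<Rightarrow> (real \<Rightarrow> 'a) \<Rightarrow> (real \<Rightarrow> 'a) \<Rightarrow> bool" where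
  "strongly_asymptotic d \<gamma> \<sigma> \<longleftrightarrow> (\<exists>T. ((\<lambda>t. d (\<gamma> t) (\<sigma> (t + T))) \<longlongrightarrow> 0) at_top)"

definition geodesic_visibility :: "(complex ^ 'd) set \<Rightarrow> bool" where
  "geodesic_visibility \<Omega> \<longleftrightarrow>
     (\<forall>p\<in>frontier \<Omega>. \<forall>q\<in>frontier \<Omega>. p \<noteq> q \<longrightarrow>
        (\<exists>U V K. open U \<and> p \<in> U \<and> open V \<and> q \<in> V \<and> closure U \<inter> closure V = {} \<and>
           compact K \<and> K \<subseteq> \<Omega> \<and>
           (\<forall>a b \<gamma>. geodesic_segment \<Omega> (kobayashi \<Omega>) a b \<gamma> \<and> \<gamma> a \<in> U \<and> \<gamma> b \<in> V \<longrightarrow>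
              \<gamma> ` {a..b} \<inter> K \<noteq> {})))"


section \<open>Continuous functions modulo constants\<close>

definition cfuns :: "'a topology \<Rightarrow> ('a \<Rightarrow> real) set" where
  "cfuns X = {f \<in> extensional (topspace X). continuous_map X euclideanreal f}"

definition compact_convergence :: "'a topology \<Rightarrow> ('a \<Rightarrow> real) topology" where
  "compact_convergence X = topology (\<lambda>U. U \<subseteq> cfuns X \<and>
     (\<forall>f\<in>U. \<exists>K e. compactin X K \<and> 0 < e \<and> {g \<in> cfuns X. \<forall>x\<in>K. \<bar>g x - f x\<bar> < e} \<subseteq> U))"

lemma openin_compact_convergence:
  "openin (compact_convergence X) U \<longleftrightarrow> U \<subseteq> cfuns X \<and>
     (\<forall>f\<in>U. \<exists>K e. compactin X K \<and> 0 < e \<and> {g \<in> cfuns X. \<forall>x\<in>K. \<bar>g x - f x\<bar> < e} \<subseteq> U)"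
proof -
  let ?P = "\<lambda>U. U \<subseteq> cfuns X \<and>
     (\<forall>f\<in>U. \<exists>K e. compactin X K \<and> 0 < e \<and> {g \<in> cfuns X. \<forall>x\<in>K. \<bar>g x - f x\<bar> < e} \<subseteq> U)"
  have "istopology ?P"
    unfolding istopology_def
  proof (intro conjI allI impI)
    fix S T assume S: "?P S" and T: "?P T"
    show "S \<inter> T \<subseteq> cfuns X" using S by blast
    show "\<forall>f\<in>S \<inter> T. \<exists>K e. compactin X K \<and> 0 < e \<and>
            {g \<in> cfuns X. \<forall>x\<in>K. \<bar>g x - f x\<bar> < e} \<subseteq> S \<inter> T"
    proof
      fix f assume f: "f \<in> S \<inter> T"
      obtain K e where 1: "compactin X K" "0 < e" "{g \<in> cfuns X. \<forall>x\<in>K. \<bar>g x - f x\<bar> < e} \<subseteq> S"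
        using S f by blast
      obtain L r where 2: "compactin X L" "0 < r" "{g \<in> cfuns X. \<forall>x\<in>L. \<bar>g x - f x\<bar> < r} \<subseteq> T"
        using T f by blast
      have "compactin X (K \<union> L)" "0 < min e r"
        using 1 2 by (auto intro: compactin_Un)
      moreover have "{g \<in> cfuns X. \<forall>x\<in>K \<union> L. \<bar>g x - f x\<bar> < min e r} \<subseteq> S \<inter> T"
        using 1(3) 2(3) by fastforce
      ultimately show "\<exists>K e. compactin X K \<and> 0 < e \<and>
            {g \<in> cfuns X. \<forall>x\<in>K. \<bar>g x - f x\<bar> < e} \<subseteq> S \<inter> T" by blast
    qed
  next
    fix \<K> assume k: "\<forall>U\<in>\<K>. ?P U"
    show "\<Union>\<K> \<subseteq> cfuns X" using k by blast
    show "\<forall>f\<in>\<Union>\<K>. \<exists>K e. compactin X K \<and> 0 < e \<and> {g \<in> cfuns X. \<forall>x\<in>K. \<bar>g x - f x\<bar> < e} \<subseteq> \<Union>\<K>"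
    proof
      fix f assume "f \<in> \<Union>\<K>"
      then obtain U where U: "U \<in> \<K>" "f \<in> U" by blast
      with k obtain K e where "compactin X K" "0 < e" "{g \<in> cfuns X. \<forall>x\<in>K. \<bar>g x - f x\<bar> < e} \<subseteq> U"
        by meson
      with U show "\<exists>K e. compactin X K \<and> 0 < e \<and> {g \<in> cfuns X. \<forall>x\<in>K. \<bar>g x - f x\<bar> < e} \<subseteq> \<Union>\<K>"
        by blast
    qed
  qed
  then show ?thesis
    unfolding compact_convergence_def by simp
qed

lemma topspace_compact_convergence [simp]: "topspace (compact_convergence X) = cfuns X"
proof
  show "topspace (compact_convergence X) \<subseteq> cfuns X"
    using openin_compact_convergence openin_topspace by blast
  have "openin (compact_convergence X) (cfuns X)"
    unfolding openin_compact_convergence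
    by (metis (no_types, lifting) compactin_empty mem_Collect_eq subsetI zero_less_one)
  then show "cfuns X \<subseteq> topspace (compact_convergence X)"
    by (rule openin_subset)
qed

text \<open>The class \<open>[f]\<close>; only the values of \<open>f\<close> on \<open>topspace X\<close> matter.\<close>

definition mod_const :: "'a topology \<Rightarrow> ('a \<Rightarrow> real) \<Rightarrow> ('a \<Rightarrow> real) set" where
  "mod_const X f = {g \<in> cfuns X. \<exists>c. \<forall>x\<in>topspace X. g x = f x + c}"

definition cstar_topology :: "'a topology \<Rightarrow> ('a \<Rightarrow> real) set topology" where
  "cstar_topology X = topology (\<lambda>V. V \<subseteq> mod_const X ` cfuns X \<and>
     openin (compact_convergence X) {f \<in> cfuns X. mod_const X f \<in> V})"

lemma openin_cstar_topology:
  "openin (cstar_topology X) V \<longleftrightarrow> V \<subseteq> mod_const X ` cfuns X \<and>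
     openin (compact_convergence X) {f \<in> cfuns X. mod_const X f \<in> V}"
proof -
  let ?Q = "\<lambda>V. {f \<in> cfuns X. mod_const X f \<in> V}"
  let ?P = "\<lambda>V. V \<subseteq> mod_const X ` cfuns X \<and> openin (compact_convergence X) (?Q V)"
  have "istopology ?P"
    unfolding istopology_def
  proof (rule conjI)
    have "?Q (S \<inter> T) = ?Q S \<inter> ?Q T" for S T by blast
    then show "\<forall>S T. ?P S \<longrightarrow> ?P T \<longrightarrow> ?P (S \<inter> T)"
      by (metis (no_types, lifting) le_infI1 openin_Int)
    have "?Q (\<Union>\<K>) = \<Union> (?Q ` \<K>)" for \<K> by blast
    then show "\<forall>\<K>. (\<forall>S\<in>\<K>. ?P S) \<longrightarrow> ?P (\<Union>\<K>)"
      by (auto intro!: openin_Union)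
  qed
  then show ?thesis
    unfolding cstar_topology_def by simp
qed

lemma topspace_cstar_topology [simp]: "topspace (cstar_topology X) = mod_const X ` cfuns X"
proof
  show "topspace (cstar_topology X) \<subseteq> mod_const X ` cfuns X"
    using openin_cstar_topology openin_topspace by blast
  have "{f \<in> cfuns X. mod_const X f \<in> mod_const X ` cfuns X} = topspace (compact_convergence X)"
    by auto
  then have "openin (cstar_topology X) (mod_const X ` cfuns X)"
    unfolding openin_cstar_topology using openin_topspace [of "compact_convergence X"] by simp
  then show "mod_const X ` cfuns X \<subseteq> topspace (cstar_topology X)"
    by (rule openin_subset)
qed

lemma quotient_map_mod_const:
  "quotient_map (compact_convergence X) (cstar_topology X) (mod_const X)"
  unfolding quotient_map_def by (simp add: openin_cstar_topology)

lemma mod_const_eqI: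
  assumes "\<And>x. x \<in> topspace X \<Longrightarrow> f x = g x + c"
  shows "mod_const X f = mod_const X g"
proof -
  have "(\<exists>e. \<forall>x\<in>topspace X. h x = f x + e) \<longleftrightarrow> (\<exists>e. \<forall>x\<in>topspace X. h x = g x + e)" for h :: "'a \<Rightarrow> real"
  proof
    assume "\<exists>e. \<forall>x\<in>topspace X. h x = f x + e"
    then obtain e where "\<forall>x\<in>topspace X. h x = f x + e" ..
    then have "\<forall>x\<in>topspace X. h x = g x + (c + e)" using assms by simp
    then show "\<exists>e. \<forall>x\<in>topspace X. h x = g x + e" ..
  next
    assume "\<exists>e. \<forall>x\<in>topspace X. h x = g x + e"
    then obtain e where "\<forall>x\<in>topspace X. h x = g x + e" ..
    then have "\<forall>x\<in>topspace X. h x = f x + (e - c)" using assms by simp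
    then show "\<exists>e. \<forall>x\<in>topspace X. h x = f x + e" ..
  qed
  then show ?thesis unfolding mod_const_def by simp
qed


section \<open>Horofunction compactification and Busemann functions\<close>

definition horo_map :: "'a set \<Rightarrow> ('a \<Rightarrow> 'a \<Rightarrow> real) \<Rightarrow> 'a \<Rightarrow> ('a \<Rightarrow> real) set" where
  "horo_map M d x = mod_const (Metric_space.mtopology M d) (\<lambda>y. d x y)"

definition horofunction_compactification ::
    "'a set \<Rightarrow> ('a \<Rightarrow> 'a \<Rightarrow> real) \<Rightarrow> ('a \<Rightarrow> real) set topology" where
  "horofunction_compactification M d =
     (let C = cstar_topology (Metric_space.mtopology M d)
      in subtopology C (C closure_of (horo_map M d ` M)))"

definition busemann :: "('a \<Rightarrow> 'a \<Rightarrow> real) \<Rightarrow> (real \<Rightarrow> 'a) \<Rightarrow> 'a \<Rightarrow> 'a \<Rightarrow> real" where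
  "busemann d \<gamma> x y = Lim at_top (\<lambda>t. d x (\<gamma> t) - d (\<gamma> t) y)"

text \<open>The class \<open>[B\<^sub>\<gamma>]\<close>, with base point \<open>\<gamma> 0\<close>; see \<open>busemann_class_basepoint\<close> below.\<close>

definition busemann_class :: "'a set \<Rightarrow> ('a \<Rightarrow> 'a \<Rightarrow> real) \<Rightarrow> (real \<Rightarrow> 'a) \<Rightarrow> ('a \<Rightarrow> real) set" where
  "busemann_class M d \<gamma> = mod_const (Metric_space.mtopology M d) (\<lambda>x. busemann d \<gamma> x (\<gamma> 0))"

context Metric_space
begin

lemma tendsto_dist_ray_minus:
  assumes \<gamma>: "geodesic_ray M d \<gamma>" and x: "x \<in> M"
  shows "\<exists>l. ((\<lambda>t. d x (\<gamma> t) - t) \<longlongrightarrow> l) at_top"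
proof -
  let ?f = "\<lambda>t. d x (\<gamma> t) - t"
  have M: "\<gamma> t \<in> M" if "0 \<le> t" for t
    using \<gamma> that unfolding geodesic_ray_def by auto
  have iso: "d (\<gamma> s) (\<gamma> t) = \<bar>s - t\<bar>" if "0 \<le> s" "0 \<le> t" for s t
    using \<gamma> that unfolding geodesic_ray_def by auto
  have anti: "?f t \<le> ?f s" if "0 \<le> s" "s \<le> t" for s t
    using triangle [OF x M [of s] M [of t]] iso [of s t] that by simp
  have below: "- d x (\<gamma> 0) \<le> ?f t" if "0 \<le> t" for t
    using triangle [OF M [of 0] x M [of t]] iso [of 0 t] commute [of x "\<gamma> 0"] that by simp
  let ?l = "Inf (?f ` {0..})"
  have bdd: "bdd_below (?f ` {0..})"
    using below by (auto intro!: bdd_belowI [of _ "- d x (\<gamma> 0)"])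
  have "(?f \<longlongrightarrow> ?l) at_top"
  proof (rule decreasing_tendsto)
    show "\<forall>\<^sub>F t in at_top. ?l \<le> ?f t"
      using eventually_ge_at_top [of 0]
      by (rule eventually_mono) (auto intro!: cInf_lower bdd)
    fix u assume "?l < u"
    then obtain s where s: "0 \<le> s" "?f s < u"
      using cInf_lessD [of "?f ` {0..}" u] by auto
    show "\<forall>\<^sub>F t in at_top. ?f t < u"
      using eventually_ge_at_top [of s]
      by (rule eventually_mono) (use anti s in fastforce)
  qed
  then show ?thesis ..
qed

lemma tendsto_busemann:
  assumes "geodesic_ray M d \<gamma>" and "x \<in> M" "y \<in> M"
  shows "((\<lambda>t. d x (\<gamma> t) - d (\<gamma> t) y) \<longlongrightarrow> busemann d \<gamma> x y) at_top"
proof -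
  obtain l m where "((\<lambda>t. d x (\<gamma> t) - t) \<longlongrightarrow> l) at_top" "((\<lambda>t. d y (\<gamma> t) - t) \<longlongrightarrow> m) at_top"
    using tendsto_dist_ray_minus assms by blast
  then have "((\<lambda>t. (d x (\<gamma> t) - t) - (d y (\<gamma> t) - t)) \<longlongrightarrow> l - m) at_top"
    by (rule tendsto_diff)
  then have *: "((\<lambda>t. d x (\<gamma> t) - d (\<gamma> t) y) \<longlongrightarrow> l - m) at_top"
    by (simp add: commute [of _ y])
  then show ?thesis
    unfolding busemann_def by (metis tendsto_Lim trivial_limit_at_top_linorder)
qed

lemma busemann_class_basepoint:
  assumes \<gamma>: "geodesic_ray M d \<gamma>" and y: "y \<in> M"
  shows "mod_const mtopology (\<lambda>x. busemann d \<gamma> x y) = busemann_class M d \<gamma>"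
proof -
  have 0: "\<gamma> 0 \<in> M" using \<gamma> unfolding geodesic_ray_def by auto
  have "busemann d \<gamma> x y = busemann d \<gamma> x (\<gamma> 0) + busemann d \<gamma> (\<gamma> 0) y" if x: "x \<in> M" for x
  proof -
    have "((\<lambda>t. (d x (\<gamma> t) - d (\<gamma> t) (\<gamma> 0)) + (d (\<gamma> 0) (\<gamma> t) - d (\<gamma> t) y))
            \<longlongrightarrow> busemann d \<gamma> x (\<gamma> 0) + busemann d \<gamma> (\<gamma> 0) y) at_top"
      by (intro tendsto_add tendsto_busemann \<gamma> x y 0)
    then have "((\<lambda>t. d x (\<gamma> t) - d (\<gamma> t) y)
            \<longlongrightarrow> busemann d \<gamma> x (\<gamma> 0) + busemann d \<gamma> (\<gamma> 0) y) at_top"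
      by (simp add: commute [of _ "\<gamma> 0"])
    then show ?thesis
      using tendsto_busemann [OF \<gamma> x y] tendsto_unique trivial_limit_at_top_linorder by blast
  qed
  then show ?thesis
    unfolding busemann_class_def by (intro mod_const_eqI) simp
qed

end

text \<open>The choice of ray in \<open>Psi\<close> is immaterial once the map is known to be well defined.\<close>

definition Psi :: "(complex ^ 'd) set \<Rightarrow> complex ^ 'd \<Rightarrow> (complex ^ 'd \<Rightarrow> real) set" where
  "Psi \<Omega> \<xi> =
     (if \<xi> \<in> \<Omega>
      then mod_const (Metric_space.mtopology \<Omega> (kobayashi \<Omega>)) (\<lambda>z. kobayashi \<Omega> z \<xi>)
      else busemann_class \<Omega> (kobayashi \<Omega>)
             (SOME \<gamma>. geodesic_ray \<Omega> (kobayashi \<Omega>) \<gamma> \<and> lands_at \<gamma> \<xi>))"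

end

theory Submission
  imports Defs "HOL-Complex_Analysis.Riemann_Mapping"
begin

text \<open>
  Write \<open>d\<close> for the Kobayashi distance. Choosing a base point \<open>p\<close>, a class modulo constants
  has exactly one representative vanishing at \<open>p\<close>; the representative of \<open>\<Psi> \<xi>\<close> is \<open>H \<xi> =
  d(\<cdot>, \<xi>) - d(\<xi>, p)\<close> for \<open>\<xi>\<close> inside the domain and the Busemann function \<open>B\<^sub>\<gamma>(\<cdot>, p)\<close> of a ray
  \<open>\<gamma>\<close> landing at \<open>\<xi>\<close> for \<open>\<xi>\<close> on the boundary. So the theorem is about the dependence of \<open>H \<xi>\<close>
  on \<open>\<xi>\<close>, and the argument rests on three facts.

  Visibility says that geodesics joining a point near a boundary point \<open>\<xi>\<close> to a point away
  from \<open>\<xi>\<close> pass at bounded distance from \<open>p\<close>, which is a lower bound \<open>d(y, z) \<ge> d(p, y) + d(p,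
  z) - 2 R\<close> (\<open>visibility_separation\<close>). Since \<open>z\<close> may be any point outside a ball around \<open>\<xi>\<close>,
  this also controls the points going to infinity in \<open>\<complex>\<^sup>d\<close>. Afterwards this inequality is the
  only form in which visibility is used.

  Continuity. Let points \<open>z\<close> of the domain tend to a boundary point \<open>\<xi>\<close>. By compactness the
  geodesics from \<open>p\<close> to \<open>z\<close> cluster at a ray \<open>g\<close>, and the lower bound forces \<open>g\<close> to land at
  \<open>\<xi>\<close> (\<open>limit_ray\<close>). Following the geodesic to time \<open>t\<close> gives \<open>d(x, z) - d(z, p) \<le> d(x, g t) -
  t + \<epsilon>\<close>, and the right-hand side decreases to \<open>B\<^sub>g(x, p) + \<epsilon>\<close>; exchanging \<open>x\<close> and \<open>p\<close> bounds
  the same difference from below. The two rays that occur may differ, but both land at \<open>\<xi>\<close>, so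
  they are strongly asymptotic and have equal Busemann functions
  (\<open>busemann_eq_of_common_endpoint\<close>). Hence \<open>H z \<longlonglongrightarrow> H \<xi>\<close> (\<open>tendsto_horo\<close>).

  Continuity of the inverse. Along a ray from \<open>p\<close> landing at \<open>\<xi>\<close>, \<open>H \<xi>\<close> is \<open>-t\<close>, whereas the
  lower bound makes \<open>H \<eta>\<close> at least \<open>t - 2 R\<close> for every \<open>\<eta>\<close> away from \<open>\<xi>\<close>. So the value at one
  point of the ray tells \<open>\<xi>\<close> from all \<open>\<eta>\<close> outside a given neighbourhood. For \<open>\<xi>\<close> in the domain
  one uses instead that \<open>H \<xi>\<close> has its minimum at \<open>\<xi>\<close>, while \<open>H \<eta>\<close> decreases at unit speed from
  \<open>\<xi>\<close> in the direction of \<open>\<eta>\<close> (\<open>horo_identifies_point\<close>). Injectivity is contained in these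
  statements.

  It remains to know that \<open>(\<Omega>, d)\<close> is a proper geodesic space carrying the Euclidean
  topology. A chain of discs whose length is close to \<open>d(x, y)\<close> contains a connected set from
  \<open>x\<close> to \<open>y\<close> on which \<open>d(x, \<cdot>) + d(\<cdot>, y)\<close> is close to \<open>d(x, y)\<close>; such sets give both the
  agreement of the topologies (\<open>kobayashi_topology\<close>) and the length property, and the rest is
  the Hopf-Rinow theorem.
\<close>

section \<open>Geodesics in proper length spaces\<close>

context Metric_space
begin

text \<open>
  An Arzela-Ascoli argument without subsequences: by Tychonoff's theorem the maps \<open>g i\<close>, seen
  as points of the product of the compact sets \<open>C t\<close>, have a cluster point, and being an
  isometry is a condition on two coordinates at a time, so it passes to the cluster point.
  Allowing any filter lets the same lemma produce geodesic segments from finer and finer grids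
  and geodesic rays from segments whose endpoint tends to the boundary.
\<close>

lemma approximate_isometries_cluster:
  fixes g :: "'i \<Rightarrow> real \<Rightarrow> 'a"
  assumes F: "F \<noteq> bot" and C: "\<And>t. t \<in> I \<Longrightarrow> compactin mtopology (C t)"
    and gC: "eventually (\<lambda>i. \<forall>t\<in>I. g i t \<in> C t) F"
    and iso: "\<And>s t. \<lbrakk>s \<in> I; t \<in> I\<rbrakk> \<Longrightarrow> ((\<lambda>i. d (g i s) (g i t)) \<longlongrightarrow> \<bar>s - t\<bar>) F"
  obtains h where "\<And>t. t \<in> I \<Longrightarrow> h t \<in> C t"
    and "\<And>s t. \<lbrakk>s \<in> I; t \<in> I\<rbrakk> \<Longrightarrow> d (h s) (h t) = \<bar>s - t\<bar>"
    and "\<And>t e. \<lbrakk>t \<in> I; 0 < e\<rbrakk> \<Longrightarrow> frequently (\<lambda>i. d (g i t) (h t) < e) F"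
proof -
  let ?X = "product_topology (\<lambda>_. mtopology) I" and ?P = "PiE I C"
  have comp: "compactin ?X ?P" by (simp add: compactin_PiE C)
  have "\<exists>h\<in>?P. \<forall>U. openin ?X U \<and> h \<in> U \<longrightarrow> frequently (\<lambda>i. restrict (g i) I \<in> U) F"
  proof (rule ccontr)
    assume "\<not> ?thesis"
    then have "\<forall>p\<in>?P. \<exists>U. openin ?X U \<and> p \<in> U \<and> eventually (\<lambda>i. restrict (g i) I \<notin> U) F"
      unfolding frequently_def by blast
    then obtain U where U: "\<And>p. p \<in> ?P \<Longrightarrow>
        openin ?X (U p) \<and> p \<in> U p \<and> eventually (\<lambda>i. restrict (g i) I \<notin> U p) F"
      by metis
    have "\<exists>\<F>. finite \<F> \<and> \<F> \<subseteq> U ` ?P \<and> ?P \<subseteq> \<Union>\<F>"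
    proof (rule compactinD [OF comp])
      show "openin ?X V" if "V \<in> U ` ?P" for V
        using that by (elim imageE) (simp only: U)
      show "?P \<subseteq> \<Union>(U ` ?P)" by (rule subsetI, rule UN_I, assumption) (simp only: U)
    qed
    then obtain \<F> where \<F>: "finite \<F>" "\<F> \<subseteq> U ` ?P" "?P \<subseteq> \<Union>\<F>" by (elim exE conjE)
    have "eventually (\<lambda>i. \<forall>V\<in>\<F>. restrict (g i) I \<notin> V) F"
    proof (intro eventually_ball_finite [OF \<F>(1)] ballI)
      fix V assume "V \<in> \<F>"
      then have "V \<in> U ` ?P" using \<F>(2) by (rule rev_subsetD)
      then show "eventually (\<lambda>i. restrict (g i) I \<notin> V) F" by (elim imageE) (simp only: U not_False_eq_True)
    qed
    with gC have "eventually (\<lambda>i. False) F"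
    proof eventually_elim
      case (elim i)
      have "restrict (g i) I \<in> ?P" using elim(1) by (auto simp: PiE_iff)
      with elim(2) \<F>(3) show False by blast
    qed
    with F show False by simp
  qed
  then obtain h where hP: "h \<in> ?P"
    and h: "\<And>U. openin ?X U \<Longrightarrow> h \<in> U \<Longrightarrow> frequently (\<lambda>i. restrict (g i) I \<in> U) F"
    by blast
  have hC: "h t \<in> C t" "h t \<in> M" if "t \<in> I" for t
    using hP that compactin_subset_topspace [OF C [OF that]] by auto
  have gM: "eventually (\<lambda>i. \<forall>t\<in>I. g i t \<in> M) F"
    using gC
  proof eventually_elim
    case (elim i)
    show ?case
    proof
      fix t assume "t \<in> I"
      then show "g i t \<in> M" using elim compactin_subset_topspace [OF C, of t] by auto
    qed
  qed
  have near: "frequently (\<lambda>i. d (g i s) (h s) < e \<and> d (g i t) (h t) < e) F"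
    if st: "s \<in> I" "t \<in> I" and e: "0 < e" for s t e
  proof -
    let ?V = "\<lambda>u. {f \<in> topspace ?X. f u \<in> mball (h u) e}"
    have op: "openin ?X (?V u)" if "u \<in> I" for u
      using that by (intro openin_continuous_map_preimage [OF continuous_map_product_projection]) auto
    have "h \<in> ?V s \<inter> ?V t"
      using hC st e hP by (auto simp: PiE_iff)
    with op have "frequently (\<lambda>i. restrict (g i) I \<in> ?V s \<inter> ?V t) F"
      using h st by (meson openin_Int)
    then show ?thesis
      by (rule frequently_elim1) (use st in \<open>auto simp: commute\<close>)
  qed
  have "d (h s) (h t) = \<bar>s - t\<bar>" if st: "s \<in> I" "t \<in> I" for s t
  proof (rule ccontr)
    assume ne: "d (h s) (h t) \<noteq> \<bar>s - t\<bar>"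
    define e where "e = \<bar>d (h s) (h t) - \<bar>s - t\<bar>\<bar> / 3"
    have e: "0 < e" using ne by (simp add: e_def)
    have "eventually (\<lambda>i. \<bar>d (g i s) (g i t) - \<bar>s - t\<bar>\<bar> < e) F"
      using tendstoD [OF iso [OF st] e] by (simp add: dist_real_def)
    with gM have "eventually (\<lambda>i. \<not> (d (g i s) (h s) < e \<and> d (g i t) (h t) < e)) F"
    proof eventually_elim
      case (elim i)
      have M: "g i s \<in> M" "g i t \<in> M" "h s \<in> M" "h t \<in> M" using elim hC st by auto
      have "d (g i s) (g i t) \<le> d (g i s) (h s) + d (h s) (h t) + d (g i t) (h t)"
        using triangle [of "g i s" "h s" "g i t"] triangle [of "h s" "h t" "g i t"] M
        by (simp add: commute)
      moreover have "d (h s) (h t) \<le> d (g i s) (h s) + d (g i s) (g i t) + d (g i t) (h t)"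
        using triangle [of "h s" "g i s" "h t"] triangle [of "g i s" "g i t" "h t"] M
        by (simp add: commute)
      moreover have "\<bar>d (h s) (h t) - \<bar>s - t\<bar>\<bar> = 3 * e" by (simp add: e_def)
      ultimately show ?case using elim(2) by (intro notI, elim conjE) linarith
    qed
    with near [OF st e] show False by (simp add: frequently_def)
  qed
  moreover have "frequently (\<lambda>i. d (g i t) (h t) < e) F" if "t \<in> I" "0 < e" for t e
    using near [OF that(1) that(1) that(2)] by (rule frequently_elim1) simp
  ultimately show thesis using hC that by blast
qed

text \<open>
  The distance is an infimum of lengths of curves, expressed through distances alone: a curve
  of nearly minimal length from \<open>x\<close> to \<open>y\<close> meets every sphere about \<open>x\<close> of radius at most
  \<open>d(x, y)\<close>, in a point almost realising equality in the triangle inequality.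
\<close>

definition length_space :: bool where
  "length_space \<longleftrightarrow> (\<forall>x\<in>M. \<forall>y\<in>M. \<forall>s e. 0 \<le> s \<and> s \<le> d x y \<and> 0 < e \<longrightarrow>
     (\<exists>z\<in>M. d x z = s \<and> d z y \<le> d x y - s + e))"

lemma length_spaceD:
  assumes length_space "x \<in> M" "y \<in> M" "0 \<le> s" "s \<le> d x y" "0 < e"
  obtains z where "z \<in> M" "d x z = s" "d z y \<le> d x y - s + e"
  using assms unfolding length_space_def by meson

lemma mtotally_bounded_closedin_imp_compactin:
  assumes mcomplete "closedin mtopology S" "mtotally_bounded S"
  shows "compactin mtopology S"
  using assms mtotally_bounded_eq_compact_closure_of [of S] by (simp add: closure_of_closedin)

lemma compactin_finite_net:
  assumes "compactin mtopology S" "0 < e"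
  obtains K where "finite K" "K \<subseteq> S" "S \<subseteq> (\<Union>k\<in>K. mball k e)"
proof -
  have "\<forall>e>0. \<exists>K. finite K \<and> K \<subseteq> S \<and> S \<subseteq> (\<Union>k\<in>K. mball k e)"
    using compactin_imp_mtotally_bounded [OF assms(1)] unfolding mtotally_bounded_def .
  with assms(2) have "\<exists>K. finite K \<and> K \<subseteq> S \<and> S \<subseteq> (\<Union>k\<in>K. mball k e)" by (elim allE impE)
  then show thesis using that by (elim exE conjE)
qed

text \<open>
  The radii of compact balls about \<open>x\<close> form an interval. It is closed above, because the
  length property puts the ball of radius \<open>R\<close> into a small neighbourhood of a smaller ball,
  which makes it totally bounded; it is open above, because a Lebesgue number of a cover of
  the compact ball of radius \<open>R\<close> by open balls inside compact ones still controls a slightly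
  larger ball.
\<close>

theorem Hopf_Rinow:
  assumes complete: mcomplete
    and local: "\<And>x. x \<in> M \<Longrightarrow> \<exists>r>0. compactin mtopology (mcball x r)"
    and length: length_space
  shows "compactin mtopology (mcball x r)"
proof (cases "x \<in> M")
  case False
  then have "mcball x r = {}" by (simp add: mcball_eq_empty)
  then show ?thesis by simp
next
  case x: True
  have smaller: "compactin mtopology (mcball x s)" if "compactin mtopology (mcball x t)" "s \<le> t" for s t
    using closed_compactin [OF that(1) mcball_subset_concentric [OF that(2)]] by simp
  have limit: "compactin mtopology (mcball x R)"
    if less: "\<And>s. s < R \<Longrightarrow> compactin mtopology (mcball x s)" and R: "0 < R" for R
  proof (rule mtotally_bounded_closedin_imp_compactin [OF complete closedin_mcball])
    show "mtotally_bounded (mcball x R)"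
      unfolding mtotally_bounded_def
    proof (intro allI impI)
      fix e :: real assume e: "0 < e"
      \<comment> \<open>The maximum keeps the radius nonnegative when \<open>e\<close> is large compared with \<open>R\<close>.\<close>
      define \<rho> where "\<rho> = max 0 (R - e/3)"
      have \<rho>: "0 \<le> \<rho>" "\<rho> < R" "R - e/3 \<le> \<rho>" using e R by (auto simp: \<rho>_def)
      obtain K where K: "finite K" "K \<subseteq> mcball x \<rho>" "mcball x \<rho> \<subseteq> (\<Union>k\<in>K. mball k (e/3))"
        by (rule compactin_finite_net [OF less [OF \<rho>(2)], of "e/3"]) (use e in simp)
      have "mcball x R \<subseteq> (\<Union>k\<in>K. mball k e)"
      proof
        fix y assume "y \<in> mcball x R"
        then have y: "y \<in> M" "d x y \<le> R" by auto
        have "\<exists>z\<in>mcball x \<rho>. d z y < 2 * e / 3"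
        proof (cases "d x y \<le> \<rho>")
          case True
          then show ?thesis using x y e by (intro bexI [of _ y]) auto
        next
          case False
          then obtain z where "z \<in> M" "d x z = \<rho>" "d z y \<le> d x y - \<rho> + e/4"
            using length_spaceD [OF length x y(1) \<rho>(1), of "e/4"] e by (auto simp del: zero)
          then show ?thesis using y \<rho> x e by (intro bexI [of _ z]) auto
        qed
        then obtain z where z: "z \<in> mcball x \<rho>" "d z y < 2 * e / 3" by blast
        then obtain k where k: "k \<in> K" "z \<in> mball k (e/3)" using K by blast
        then have "d k y < e" using triangle [of k z y] z y by auto
        then show "y \<in> (\<Union>k\<in>K. mball k e)" using k y by auto
      qed
      moreover have "K \<subseteq> mcball x R" using K(2) \<rho> by fastforce
      ultimately show "\<exists>K. finite K \<and> K \<subseteq> mcball x R \<and> mcball x R \<subseteq> (\<Union>k\<in>K. mball k e)"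
        using K(1) by blast
    qed
  qed
  have extend: "\<exists>e>0. compactin mtopology (mcball x (R + e))"
    if R: "compactin mtopology (mcball x R)" "0 \<le> R" for R
  proof -
    let ?\<C> = "{mball y r |y r. compactin mtopology (mcball y r)}"
    have cover: "mcball x R \<subseteq> \<Union>?\<C>"
    proof
      fix y assume "y \<in> mcball x R"
      then have y: "y \<in> M" by auto
      with local obtain r where "0 < r" "compactin mtopology (mcball y r)" by blast
      with y show "y \<in> \<Union>?\<C>" by (intro UnionI [of "mball y r"]) auto
    qed
    have opens: "U \<in> ?\<C> \<Longrightarrow> openin mtopology U" for U by auto
    have "\<exists>e>0. \<forall>z\<in>mcball x R. \<exists>U\<in>?\<C>. mball z e \<subseteq> U"
      by (rule lebesgue_number [OF R(1) cover]) (rule opens)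
    then obtain e where e: "0 < e" "\<forall>z\<in>mcball x R. \<exists>U\<in>?\<C>. mball z e \<subseteq> U" by (elim exE conjE)
    obtain K where K: "finite K" "K \<subseteq> mcball x R" "mcball x R \<subseteq> (\<Union>k\<in>K. mball k (e/3))"
      by (rule compactin_finite_net [OF R(1), of "e/3"]) (use e(1) in simp)
    have "mtotally_bounded (mball k e)" if k: "k \<in> K" for k
    proof -
      obtain y r where yr: "compactin mtopology (mcball y r)" "mball k e \<subseteq> mball y r"
        using bspec [OF e(2) subsetD [OF K(2) k]] by blast
      then have "mball k e \<subseteq> mcball y r" using mball_subset_mcball by blast
      with yr show ?thesis using compactin_imp_mtotally_bounded mtotally_bounded_subset by blast
    qed
    then have tb: "mtotally_bounded (\<Union>k\<in>K. mball k e)"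
      using K(1) by (intro mtotally_bounded_Union) auto
    have sub: "mcball x (R + e/3) \<subseteq> (\<Union>k\<in>K. mball k e)"
    proof
      fix y assume "y \<in> mcball x (R + e/3)"
      then have y: "y \<in> M" "d x y \<le> R + e/3" by auto
      have "\<exists>z\<in>mcball x R. d z y < 2 * e / 3"
      proof (cases "d x y \<le> R")
        case True
        then show ?thesis using x y e(1) by (intro bexI [of _ y]) auto
      next
        case False
        then obtain z where "z \<in> M" "d x z = R" "d z y \<le> d x y - R + e/4"
          using length_spaceD [OF length x y(1) R(2), of "e/4"] e(1) by auto
        then show ?thesis using y x e(1) by (intro bexI [of _ z]) auto
      qed
      then obtain z where z: "z \<in> mcball x R" "d z y < 2 * e / 3" by blast
      then obtain k where k: "k \<in> K" "z \<in> mball k (e/3)" using K by blast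
      then have "d k y < e" using triangle [of k z y] z y by auto
      then show "y \<in> (\<Union>k\<in>K. mball k e)" using k y by auto
    qed
    have "compactin mtopology (mcball x (R + e/3))"
      by (rule mtotally_bounded_closedin_imp_compactin
          [OF complete closedin_mcball mtotally_bounded_subset [OF tb sub]])
    with e(1) show ?thesis by (intro exI [of _ "e/3"]) auto
  qed
  define S where "S = {s. 0 \<le> s \<and> compactin mtopology (mcball x s)}"
  obtain r1 where r1: "r1 > 0" "compactin mtopology (mcball x r1)" using local [OF x] by blast
  show ?thesis
  proof (rule ccontr)
    assume not: "\<not> ?thesis"
    then have bound: "s \<le> r" if "s \<in> S" for s
      using that smaller [of s r] unfolding S_def by force
    then have bdd: "bdd_above S" by (auto simp: bdd_above_def)
    have r1S: "r1 \<in> S" using r1 by (simp add: S_def)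
    have "compactin mtopology (mcball x s)" if s: "s < Sup S" for s
    proof -
      have "S \<noteq> {}" using r1S by blast
      from less_cSupD [OF this s] obtain t where "t \<in> S" "s < t" by blast
      then show ?thesis using smaller [of t s] by (simp add: S_def)
    qed
    moreover have pos: "0 < Sup S" using r1(1) cSup_upper [OF r1S bdd] by linarith
    ultimately have "compactin mtopology (mcball x (Sup S))" by (rule limit)
    then obtain e where "0 < e" "compactin mtopology (mcball x (Sup S + e))"
      using extend [OF _ less_imp_le [OF pos]] by blast
    then have "Sup S + e \<in> S" using pos by (simp add: S_def)
    from cSup_upper [OF this bdd] \<open>0 < e\<close> show False by simp
  qed
qed

lemma continuous_map_dist_left:
  assumes "y \<in> M"
  shows "continuous_map mtopology euclideanreal (\<lambda>z. d z y)"
  using assms continuous_map_mdist [of mtopology "metric (M,d)" "\<lambda>z. z" "\<lambda>_. y"] by simp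

text \<open>
  In a compact ball the error term of the length property disappears: minimise the distance
  to \<open>y\<close> over the ball of radius \<open>s\<close> about \<open>x\<close>.
\<close>

lemma proper_length_space_between:
  assumes proper: "\<And>x r. compactin mtopology (mcball x r)" and length: length_space
    and x: "x \<in> M" and y: "y \<in> M" and s: "0 \<le> s" "s \<le> d x y"
  obtains z where "z \<in> M" "d x z = s" "d z y = d x y - s"
proof -
  have "compact ((\<lambda>z. d z y) ` mcball x s)"
    using image_compactin [OF proper continuous_map_dist_left [OF y]] by simp
  moreover have "x \<in> mcball x s" using x s by simp
  ultimately obtain z where z: "z \<in> mcball x s" "\<And>w. w \<in> mcball x s \<Longrightarrow> d z y \<le> d w y"
    using compact_attains_inf [of "(\<lambda>z. d z y) ` mcball x s"] by blast
  have "d z y \<le> d x y - s"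
  proof (rule field_le_epsilon)
    fix e :: real assume "0 < e"
    then obtain w where "w \<in> M" "d x w = s" "d w y \<le> d x y - s + e"
      using length_spaceD [OF length x y s] by metis
    with z(2) [of w] x show "d z y \<le> d x y - s + e" by fastforce
  qed
  moreover have "d x y \<le> d x z + d z y" "d x z \<le> s" "z \<in> M" using z triangle x y by auto
  ultimately show thesis using that by force
qed

text \<open>
  Repeated use of the preceding lemma gives \<open>n + 2\<close> points from \<open>x\<close> to \<open>y\<close> that are isometric
  to an equidistant grid. The corresponding step functions are isometric up to twice the mesh,
  and a cluster point is a geodesic.
\<close>

theorem proper_length_space_geodesic:
  assumes proper: "\<And>x r. compactin mtopology (mcball x r)" and length: length_space
    and x: "x \<in> M" and y: "y \<in> M"
  shows "\<exists>\<gamma>. geodesic_segment M d 0 (d x y) \<gamma> \<and> \<gamma> 0 = x \<and> \<gamma> (d x y) = y"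
proof (cases "d x y = 0")
  case True
  then have "x = y" using x y by simp
  then have "geodesic_segment M d 0 (d x y) (\<lambda>_. x)"
    using x by (auto simp: geodesic_segment_def)
  then show ?thesis using \<open>x = y\<close> by blast
next
  case False
  define D where "D = d x y"
  have D: "0 < D" using False by (simp add: D_def order_less_le)
  have "\<exists>z. z 0 = x \<and> (\<forall>i. z i \<in> M) \<and>
      (\<forall>i j. i \<le> j \<and> j \<le> Suc n \<longrightarrow> d (z i) (z j) = real (j - i) * (D / Suc n)) \<and> z (Suc n) = y" for n
  proof -
    define \<delta> where "\<delta> = D / Suc n"
    have \<delta>: "0 < \<delta>" "real (Suc n) * \<delta> = D" using D by (auto simp: \<delta>_def)
    have le: "real i * \<delta> \<le> D" if "i \<le> Suc n" for i
      using mult_right_mono [of "real i" "real (Suc n)" \<delta>] \<delta> that by linarith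
    let ?P = "\<lambda>i z. z \<in> M \<and> (i = 0 \<longrightarrow> z = x) \<and> (i \<le> Suc n \<longrightarrow> d z y = D - real i * \<delta>)"
    have ex0: "?P 0 x" using x by (simp add: D_def)
    have step: "\<exists>z'. ?P (Suc i) z' \<and> (i < Suc n \<longrightarrow> d z z' = \<delta>)" if "?P i z" for i z
    proof (cases "i < Suc n")
      case True
      have zM: "z \<in> M" using that by blast
      have "\<delta> \<le> d z y" using that True le [of "Suc i"] by (simp add: algebra_simps)
      then obtain z' where z': "z' \<in> M" "d z z' = \<delta>" "d z' y = d z y - \<delta>"
        using proper_length_space_between [OF proper length zM y less_imp_le [OF \<delta>(1)]] by blast
      have "d z y = D - real i * \<delta>" using that True by simp
      then have "d z' y = D - real (Suc i) * \<delta>" unfolding z'(3) of_nat_Suc by (simp only: distrib_right)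
      with z' show ?thesis by blast
    next
      case False
      then show ?thesis using y by (intro exI [of _ y]) simp
    qed
    have "\<exists>z. \<forall>i. ?P i (z i) \<and> (i < Suc n \<longrightarrow> d (z i) (z (Suc i)) = \<delta>)"
      by (rule dependent_nat_choice [of ?P "\<lambda>i z z'. i < Suc n \<longrightarrow> d z z' = \<delta>", OF exI, OF ex0 step])
    then obtain z where "\<forall>i. ?P i (z i) \<and> (i < Suc n \<longrightarrow> d (z i) (z (Suc i)) = \<delta>)" ..
    then have z: "?P i (z i)" "i < Suc n \<Longrightarrow> d (z i) (z (Suc i)) = \<delta>" for i
      by simp_all
    have zM: "z i \<in> M" for i using z(1) by blast
    have upper: "d (z i) (z (i + k)) \<le> real k * \<delta>" if "i + k \<le> Suc n" for i k
      using that
    proof (induction k)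
      case (Suc k)
      then have "d (z i) (z (i + k)) \<le> real k * \<delta>" "d (z (i + k)) (z (i + Suc k)) = \<delta>"
        using z(2) [of "i + k"] by auto
      then show ?case
        using triangle [OF zM [of i] zM [of "i + k"] zM [of "i + Suc k"]] by (simp add: algebra_simps)
    qed (use zM in simp)
    have "d (z i) (z j) = real (j - i) * \<delta>" if ij: "i \<le> j" "j \<le> Suc n" for i j
    proof -
      have "d (z i) (z j) \<le> real (j - i) * \<delta>" using upper [of i "j - i"] ij by simp
      moreover have "d (z i) y \<le> d (z i) (z j) + d (z j) y" using triangle zM y by blast
      then have "real (j - i) * \<delta> \<le> d (z i) (z j)"
        using z(1) [of i] z(1) [of j] ij by (simp add: of_nat_diff algebra_simps)
      ultimately show ?thesis by linarith
    qed
    moreover have "z (Suc n) = y" using z(1) [of "Suc n"] \<delta> y zero [of "z (Suc n)" y] by auto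
    ultimately show ?thesis using z(1) unfolding \<delta>_def by (intro exI [of _ z]) auto
  qed
  then obtain z where "\<And>n. z n 0 = x \<and> (\<forall>i. z n i \<in> M) \<and>
      (\<forall>i j. i \<le> j \<and> j \<le> Suc n \<longrightarrow> d (z n i) (z n j) = real (j - i) * (D / Suc n)) \<and> z n (Suc n) = y"
    by metis
  then have z: "z n 0 = x" "z n i \<in> M" "z n (Suc n) = y"
      "i \<le> j \<Longrightarrow> j \<le> Suc n \<Longrightarrow> d (z n i) (z n j) = real (j - i) * (D / Suc n)" for n i j
    by blast+
  define ix where "ix n s = nat \<lfloor>s * real (Suc n) / D\<rfloor>" for n :: nat and s :: real
  define g where "g n s = z n (ix n s)" for n s
  have ix0: "ix n 0 = 0" and ixD: "ix n D = Suc n" for n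
    using D by (simp_all add: ix_def del: of_nat_Suc)
  have ix_mono: "ix n s \<le> ix n t" if "s \<le> t" for n s t
    unfolding ix_def using that D
    by (intro nat_mono floor_mono divide_right_mono mult_right_mono) auto
  have ix_approx: "\<bar>real (ix n s) * (D / Suc n) - s\<bar> \<le> D / Suc n" if s: "0 \<le> s" for n s
  proof -
    have "0 \<le> s * Suc n / D" using s D by simp
    then have "\<bar>real (ix n s) - s * Suc n / D\<bar> \<le> 1" unfolding ix_def by linarith
    then have "\<bar>real (ix n s) - s * Suc n / D\<bar> * (D / Suc n) \<le> 1 * (D / Suc n)"
      using D by (intro mult_right_mono) auto
    also have "\<bar>real (ix n s) - s * Suc n / D\<bar> * (D / Suc n) =
        \<bar>(real (ix n s) - s * Suc n / D) * (D / Suc n)\<bar>" using D by (simp add: abs_mult)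
    also have "(real (ix n s) - s * Suc n / D) * (D / Suc n) = real (ix n s) * (D / Suc n) - s"
    proof -
      have "s * real (Suc n) / D * (D / real (Suc n)) = s" using D by (simp del: of_nat_Suc)
      then show ?thesis by (simp only: left_diff_distrib)
    qed
    finally show ?thesis by simp
  qed
  have close: "\<bar>d (g n s) (g n t) - \<bar>s - t\<bar>\<bar> \<le> 2 * D / Suc n"
    if st: "0 \<le> s" "s \<le> t" "t \<le> D" for n s t
  proof -
    have "d (g n s) (g n t) = real (ix n t - ix n s) * (D / Suc n)"
      unfolding g_def using z(4) ix_mono [OF st(2)] ix_mono [OF st(3)] ixD by metis
    also have "\<dots> = real (ix n t) * (D / Suc n) - real (ix n s) * (D / Suc n)"
      using ix_mono [OF st(2), of n] by (simp add: of_nat_diff left_diff_distrib diff_divide_distrib)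
    finally have "d (g n s) (g n t) = real (ix n t) * (D / Suc n) - real (ix n s) * (D / Suc n)" .
    moreover have "\<bar>b - a - \<bar>s - t\<bar>\<bar> \<le> 2 * c" if "\<bar>a - s\<bar> \<le> c" "\<bar>b - t\<bar> \<le> c" for a b c
      using that st by linarith
    note this [OF ix_approx [of s n] ix_approx [of t n]]
    ultimately show ?thesis using st by simp
  qed
  have close': "\<bar>d (g n s) (g n t) - \<bar>s - t\<bar>\<bar> \<le> 2 * D / Suc n" if "s \<in> {0..D}" "t \<in> {0..D}" for n s t
    using close [of s t n] close [of t s n] that by (cases "s \<le> t") (auto simp: commute)
  have lim: "(\<lambda>n. d (g n s) (g n t)) \<longlonglongrightarrow> \<bar>s - t\<bar>" if st: "s \<in> {0..D}" "t \<in> {0..D}" for s t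
  proof -
    have "(\<lambda>n. 2 * D / Suc n) \<longlonglongrightarrow> 0"
      using tendsto_mult_right_zero [OF LIMSEQ_inverse_real_of_nat, of "2 * D"]
      by (simp add: divide_inverse)
    then have "(\<lambda>n. d (g n s) (g n t) - \<bar>s - t\<bar>) \<longlonglongrightarrow> 0"
      by (rule Lim_null_comparison [rotated]) (use close' st in auto)
    then show ?thesis using Lim_null by blast
  qed
  have in_ball: "g n s \<in> mcball x D" if "s \<in> {0..D}" for n s
  proof -
    have "d (z n 0) (z n (ix n s)) = real (ix n s) * (D / Suc n)"
      using z(4) [of 0 "ix n s" n] ix_mono [of s D n] ixD that by simp
    also have "\<dots> \<le> real (Suc n) * (D / Suc n)"
      using ix_mono [of s D n] ixD [of n] that D by (intro mult_right_mono) auto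
    finally show ?thesis using x z unfolding g_def by simp
  qed
  have ev: "\<forall>\<^sub>F n in sequentially. \<forall>t\<in>{0..D}. g n t \<in> mcball x D" using in_ball by simp
  obtain h where h: "\<And>t. t \<in> {0..D} \<Longrightarrow> h t \<in> mcball x D"
      "\<And>s t. \<lbrakk>s \<in> {0..D}; t \<in> {0..D}\<rbrakk> \<Longrightarrow> d (h s) (h t) = \<bar>s - t\<bar>"
      "\<And>t e. \<lbrakk>t \<in> {0..D}; 0 < e\<rbrakk> \<Longrightarrow> \<exists>\<^sub>F n in sequentially. d (g n t) (h t) < e"
  proof (rule approximate_isometries_cluster [of sequentially "{0..D}" "\<lambda>_. mcball x D" g], goal_cases)
    case (5 h)
    from 5(2-) show ?case by (rule 5(1))
  qed (assumption | rule sequentially_bot proper ev lim)+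
  have fixed: "h t = w" if t: "t \<in> {0..D}" and gw: "\<And>n. g n t = w" and w: "w \<in> M" for t w
  proof (rule ccontr)
    assume "h t \<noteq> w"
    then have "0 < d w (h t)" using h(1) [OF t] w by (auto simp: order_less_le)
    then show False using h(3) [OF t, of "d w (h t)"] gw by simp
  qed
  have "h 0 = x" using fixed [of 0 x] ix0 z(1) x D by (simp add: g_def)
  moreover have "h D = y" using fixed [of D y] ixD z(3) y D by (simp add: g_def)
  moreover have "geodesic_segment M d 0 D h"
    unfolding geodesic_segment_def using h(1,2) D by auto
  ultimately show ?thesis unfolding D_def by (intro exI [of _ h] conjI)
qed

end

section \<open>Busemann cocycles and Euclidean boundary points\<close>

text \<open>
  The properties of a complete Kobayashi hyperbolic domain on which the embedding depends,
  with \<open>closure M - M\<close> as the boundary. \<open>separation\<close> bounds the Gromov product \<open>(y | z)\<^sub>p\<close> for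
  \<open>y\<close> near a boundary point and \<open>z\<close> away from it.
\<close>

locale visibility_space = Metric_space M d
  for M :: "'a::metric_space set" and d +
  assumes mtopology_eq: "mtopology = top_of_set M"
    and proper: "compactin mtopology (mcball x r)"
    and geodesic: "\<lbrakk>x \<in> M; y \<in> M\<rbrakk> \<Longrightarrow>
      \<exists>\<gamma>. geodesic_segment M d 0 (d x y) \<gamma> \<and> \<gamma> 0 = x \<and> \<gamma> (d x y) = y"
    and separation: "\<lbrakk>\<xi> \<in> closure M - M; 0 < r; p \<in> M\<rbrakk> \<Longrightarrow>
      \<exists>\<delta>>0. \<exists>R. \<forall>y\<in>M. \<forall>z\<in>M. dist y \<xi> < \<delta> \<longrightarrow> r \<le> dist z \<xi> \<longrightarrow> d p y + d p z - 2 * R \<le> d y z"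
    and asymptotic: "\<lbrakk>\<xi> \<in> closure M - M; geodesic_ray M d \<gamma>; lands_at \<gamma> \<xi>;
      geodesic_ray M d \<sigma>; lands_at \<sigma> \<xi>\<rbrakk> \<Longrightarrow> strongly_asymptotic d \<gamma> \<sigma>"
begin

lemma geodesic_segmentD:
  assumes "geodesic_segment M d a b \<gamma>" "s \<in> {a..b}" "t \<in> {a..b}"
  shows "\<gamma> s \<in> M" "d (\<gamma> s) (\<gamma> t) = \<bar>s - t\<bar>"
  using assms unfolding geodesic_segment_def by auto

lemma geodesic_rayD:
  assumes "geodesic_ray M d \<gamma>" "0 \<le> s" "0 \<le> t"
  shows "\<gamma> s \<in> M" "d (\<gamma> s) (\<gamma> t) = \<bar>s - t\<bar>"
  using assms unfolding geodesic_ray_def by auto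

text \<open>
  Balls of \<open>d\<close> are compact, hence closed in the ambient space, so they stay away from
  boundary points.
\<close>

lemma dist_tends_to_infinity:
  assumes F: "F \<le> nhds \<xi>" "eventually (\<lambda>z. z \<in> M) F" and \<xi>: "\<xi> \<notin> M" and p: "p \<in> M"
  shows "filterlim (d p) at_top F"
  unfolding filterlim_at_top
proof
  fix Z
  have "compactin (top_of_set M) (mcball p Z)" using proper mtopology_eq by metis
  then have "compact (mcball p Z)" by (simp add: compactin_subtopology)
  then have "open (- mcball p Z)" by (simp add: compact_imp_closed open_closed)
  moreover have "\<xi> \<in> - mcball p Z" using \<xi> by auto
  ultimately have "eventually (\<lambda>z. z \<in> - mcball p Z) F"
    using F(1) eventually_nhds_in_open filter_leD by metis
  with F(2) show "eventually (\<lambda>z. Z \<le> d p z) F"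
    by eventually_elim (use p in auto)
qed

text \<open>
  The last conclusion records that, for suitable \<open>z\<close> near \<open>\<xi>\<close>, a geodesic from \<open>p\<close> to \<open>z\<close>
  passes within \<open>e\<close> of \<open>g t\<close> at time \<open>t\<close>. The ray lands at \<open>\<xi>\<close> because a point \<open>g t\<close> far from
  \<open>\<xi>\<close> has \<open>d(z, g t)\<close> at most about \<open>d(p, z) - t\<close> by that inequality and at least \<open>d(p, z) + t
  - 2 R\<close> by \<open>separation\<close>, which bounds \<open>t\<close>.
\<close>

lemma limit_ray:
  assumes F: "F \<noteq> bot" "F \<le> nhds \<xi>" "eventually (\<lambda>z. z \<in> M) F"
    and \<xi>: "\<xi> \<in> closure M - M" and p: "p \<in> M"
  obtains g where "geodesic_ray M d g" "lands_at g \<xi>" "g 0 = p"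
    and "\<And>t e. \<lbrakk>0 \<le> t; 0 < e\<rbrakk> \<Longrightarrow> frequently (\<lambda>z. z \<in> M \<and> d z (g t) < d p z - t + e) F"
proof -
  have "\<forall>z. \<exists>\<gamma>. z \<in> M \<longrightarrow> geodesic_segment M d 0 (d p z) \<gamma> \<and> \<gamma> 0 = p \<and> \<gamma> (d p z) = z"
    using geodesic [OF p] by blast
  then obtain \<gamma> where \<gamma>: "\<And>z. z \<in> M \<Longrightarrow> geodesic_segment M d 0 (d p z) (\<gamma> z)"
      "\<And>z. z \<in> M \<Longrightarrow> \<gamma> z 0 = p" "\<And>z. z \<in> M \<Longrightarrow> \<gamma> z (d p z) = z"
    by metis
  \<comment> \<open>Segments are prolonged by their endpoint so that all of them are defined on \<open>[0, \<infinity>)\<close>.\<close>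
  define k where "k z t = \<gamma> z (min t (d p z))" for z t
  have inf: "filterlim (d p) at_top F"
    using dist_tends_to_infinity [OF F(2,3) _ p] \<xi> by blast
  have long: "eventually (\<lambda>z. z \<in> M \<and> t \<le> d p z) F" for t
    using F(3) inf [unfolded filterlim_at_top, rule_format, of t] by eventually_elim simp
  have k: "k z t \<in> mcball p t" if "z \<in> M" "0 \<le> t" for z t
  proof -
    have "0 \<in> {0..d p z}" "min t (d p z) \<in> {0..d p z}" using that by auto
    note seg = geodesic_segmentD [OF \<gamma>(1) [OF that(1)] this(2) this(1)]
    then have "d p (k z t) = min t (d p z)"
      using \<gamma>(2) [OF that(1)] that unfolding k_def by (simp add: commute)
    with seg(1) p show ?thesis unfolding k_def by simp
  qed
  have kM: "eventually (\<lambda>z. \<forall>t\<in>{0..}. k z t \<in> mcball p t) F"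
    using F(3) by eventually_elim (simp del: in_mcball add: k)
  have lim: "((\<lambda>z. d (k z s) (k z t)) \<longlongrightarrow> \<bar>s - t\<bar>) F" if st: "s \<in> {0..}" "t \<in> {0..}" for s t
  proof (rule tendsto_eventually)
    show "eventually (\<lambda>z. d (k z s) (k z t) = \<bar>s - t\<bar>) F"
      using long [of s] long [of t]
    proof eventually_elim
      case (elim z)
      then show ?case
        using geodesic_segmentD(2) [OF \<gamma>(1), of z s t] st unfolding k_def by simp
    qed
  qed
  obtain h where hC: "\<And>t. t \<in> {0..} \<Longrightarrow> h t \<in> mcball p t"
      and iso: "\<And>s t. \<lbrakk>s \<in> {0..}; t \<in> {0..}\<rbrakk> \<Longrightarrow> d (h s) (h t) = \<bar>s - t\<bar>"
      and near: "\<And>t e. \<lbrakk>t \<in> {0..}; 0 < e\<rbrakk> \<Longrightarrow> \<exists>\<^sub>F z in F. d (k z t) (h t) < e"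
  proof (rule approximate_isometries_cluster [of F "{0..}" "mcball p" k], goal_cases)
    case (5 h)
    from 5(2-) show ?case by (rule 5(1))
  qed (assumption | rule F(1) proper kM lim)+
  have hM: "h t \<in> M" if "0 \<le> t" for t using hC [of t] that by auto
  have ray: "geodesic_ray M d h" unfolding geodesic_ray_def using hM iso by auto
  have "0 \<in> {0::real..}" by simp
  from hC [OF this] have h0: "h 0 = p" using p zero [of p "h 0"] nonneg [of p "h 0"] by auto
  have conv: "frequently (\<lambda>z. z \<in> M \<and> d z (h t) < d p z - t + e) F" if "0 \<le> t" "0 < e" for t e
  proof -
    have "t \<in> {0..}" using that by simp
    from frequently_eventually_frequently [OF near [OF this that(2)] long [of t]] show ?thesis
    proof (rule frequently_elim1)
      fix z assume z: "d (k z t) (h t) < e \<and> z \<in> M \<and> t \<le> d p z"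
      then have "t \<in> {0..d p z}" "d p z \<in> {0..d p z}" using that by auto
      note seg = geodesic_segmentD [OF \<gamma>(1) this] 
      have zM: "z \<in> M" using z by blast
      have "k z t = \<gamma> z t" using z unfolding k_def by simp
      then have "d z (k z t) = d p z - t" "k z t \<in> M"
        using seg [OF zM] \<gamma>(3) [OF zM] z by (auto simp: commute)
      then show "z \<in> M \<and> d z (h t) < d p z - t + e"
        using triangle [of z "k z t" "h t"] hM [OF that(1)] z by auto
    qed
  qed
  have "lands_at h \<xi>" unfolding lands_at_def
  proof (rule tendstoI)
    fix r :: real assume r: "0 < r"
    obtain \<delta> R where \<delta>: "0 < \<delta>" and R: "\<forall>y\<in>M. \<forall>z\<in>M. dist y \<xi> < \<delta> \<longrightarrow> r \<le> dist z \<xi> \<longrightarrow>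
        d p y + d p z - 2 * R \<le> d y z"
      using separation [OF \<xi> r p] by blast
    have ev: "eventually (\<lambda>z. dist z \<xi> < \<delta>) F"
      using F(2) \<delta> by (intro filter_leD [OF F(2)]) (auto simp: eventually_nhds_metric)
    show "eventually (\<lambda>t. dist (h t) \<xi> < r) at_top"
      using eventually_ge_at_top [of "max 0 (R + 1)"]
    proof eventually_elim
      case (elim t)
      then have t: "0 \<le> t" "R + 1 \<le> t" by auto
      show ?case
      proof (rule ccontr)
        assume far: "\<not> dist (h t) \<xi> < r"
        obtain z where z: "z \<in> M" "d z (h t) < d p z - t + 1" "dist z \<xi> < \<delta>"
          using frequently_ex [OF frequently_eventually_frequently [OF conv [OF t(1) zero_less_one] ev]]
          by blast
        have "d p z + d p (h t) - 2 * R \<le> d z (h t)" using R z(1,3) hM [OF t(1)] far by auto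
        moreover have "d p (h t) = t" using iso [of 0 t] t h0 by simp
        ultimately show False using z(2) t by linarith
      qed
    qed
  qed
  with ray h0 conv that show thesis by blast
qed

lemma at_boundary:
  assumes "\<xi> \<in> closure M - M"
  shows "at \<xi> within M \<noteq> bot" "at \<xi> within M \<le> nhds \<xi>" "eventually (\<lambda>z. z \<in> M) (at \<xi> within M)"
proof -
  show "at \<xi> within M \<noteq> bot"
    using assms by (auto simp: closure_def trivial_limit_within)
  show "at \<xi> within M \<le> nhds \<xi>" by (simp add: at_within_def)
  show "eventually (\<lambda>z. z \<in> M) (at \<xi> within M)" by (simp add: eventually_at_filter)
qed

lemma ex_landing_ray:
  assumes "\<xi> \<in> closure M - M" "p \<in> M"
  obtains g where "geodesic_ray M d g" "lands_at g \<xi>" "g 0 = p"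
  by (rule limit_ray [OF at_boundary [OF assms(1)] assms]) (rule that)

text \<open>
  A reparametrisation of one ray brings it arbitrarily close to the other, and a Busemann
  function does not change when its ray is shifted in time.
\<close>

lemma busemann_eq_of_common_endpoint:
  assumes \<xi>: "\<xi> \<in> closure M - M" and \<gamma>: "geodesic_ray M d \<gamma>" "lands_at \<gamma> \<xi>"
    and \<sigma>: "geodesic_ray M d \<sigma>" "lands_at \<sigma> \<xi>" and x: "x \<in> M" and y: "y \<in> M"
  shows "busemann d \<gamma> x y = busemann d \<sigma> x y"
proof -
  obtain T where T: "((\<lambda>t. d (\<gamma> t) (\<sigma> (t + T))) \<longlongrightarrow> 0) at_top"
    using asymptotic [OF \<xi> \<gamma> \<sigma>] unfolding strongly_asymptotic_def by blast
  let ?g = "\<lambda>t. d x (\<gamma> t) - d (\<gamma> t) y" and ?s = "\<lambda>t. d x (\<sigma> t) - d (\<sigma> t) y"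
  have "filterlim (\<lambda>t. t + T) at_top at_top"
    using filterlim_tendsto_add_at_top [OF tendsto_const filterlim_ident, of T] by (simp add: add.commute)
  then have s: "((\<lambda>t. ?s (t + T)) \<longlongrightarrow> busemann d \<sigma> x y) at_top"
    by (rule filterlim_compose [OF tendsto_busemann [OF \<sigma>(1) x y]])
  have "((\<lambda>t. ?g t - ?s (t + T)) \<longlongrightarrow> 0) at_top"
  proof (rule Lim_null_comparison)
    show "((\<lambda>t. 2 * d (\<gamma> t) (\<sigma> (t + T))) \<longlongrightarrow> 0) at_top"
      using tendsto_mult_right_zero [OF T] by simp
    show "eventually (\<lambda>t. norm (?g t - ?s (t + T)) \<le> 2 * d (\<gamma> t) (\<sigma> (t + T))) at_top"
      using eventually_ge_at_top [of "max 0 (- T)"]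
    proof eventually_elim
      case (elim t)
      then have M: "\<gamma> t \<in> M" "\<sigma> (t + T) \<in> M"
        using geodesic_rayD(1) [OF \<gamma>(1), of t] geodesic_rayD(1) [OF \<sigma>(1), of "t + T"] by auto
      have "\<bar>d w (\<gamma> t) - d w (\<sigma> (t + T))\<bar> \<le> d (\<gamma> t) (\<sigma> (t + T))" if "w \<in> M" for w
        using triangle [OF that M(1) M(2)] triangle [OF that M(2) M(1)] commute [of "\<gamma> t" "\<sigma> (t + T)"]
        by linarith
      from this [OF x] this [OF y] show ?case
        by (simp add: commute [of _ y])
    qed
  qed
  from tendsto_diff [OF tendsto_busemann [OF \<gamma>(1) x y] s] this
  have "busemann d \<gamma> x y - busemann d \<sigma> x y = 0"
    by (rule tendsto_unique [OF trivial_limit_at_top_linorder])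
  then show ?thesis by simp
qed

text \<open>
  The cocycle attached to a point of the closure: its class as a function of \<open>x\<close> is the image
  of \<open>\<xi>\<close> in the horofunction compactification, and \<open>y\<close> is the point of normalisation.
\<close>

definition horo :: "'a \<Rightarrow> 'a \<Rightarrow> 'a \<Rightarrow> real" where
  "horo \<xi> x y = (if \<xi> \<in> M then d x \<xi> - d \<xi> y
     else busemann d (SOME \<gamma>. geodesic_ray M d \<gamma> \<and> lands_at \<gamma> \<xi>) x y)"

lemma horo_interior: "\<xi> \<in> M \<Longrightarrow> horo \<xi> x y = d x \<xi> - d \<xi> y"
  by (simp add: horo_def)

lemma horo_boundary:
  assumes "\<xi> \<in> closure M - M" "geodesic_ray M d \<gamma>" "lands_at \<gamma> \<xi>" "x \<in> M" "y \<in> M"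
  shows "horo \<xi> x y = busemann d \<gamma> x y"
proof -
  let ?\<sigma> = "SOME \<gamma>. geodesic_ray M d \<gamma> \<and> lands_at \<gamma> \<xi>"
  have "geodesic_ray M d ?\<sigma> \<and> lands_at ?\<sigma> \<xi>"
    by (rule someI [of _ \<gamma>]) (use assms in simp)
  then have "busemann d ?\<sigma> x y = busemann d \<gamma> x y"
    using busemann_eq_of_common_endpoint assms by blast
  then show ?thesis using assms(1) by (simp add: horo_def)
qed

lemma horo_along_ray:
  assumes \<xi>: "\<xi> \<in> closure M - M" and g: "geodesic_ray M d g" "lands_at g \<xi>" and t: "0 \<le> t"
  shows "horo \<xi> (g t) (g 0) = - t"
proof -
  have M: "g t \<in> M" "g 0 \<in> M" using geodesic_rayD(1) [OF g(1)] t by auto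
  have "eventually (\<lambda>s. d (g t) (g s) - d (g s) (g 0) = - t) at_top"
    using eventually_ge_at_top [of t]
  proof eventually_elim
    case (elim s)
    then show ?case using geodesic_rayD(2) [OF g(1)] t by auto
  qed
  then have "((\<lambda>s. d (g t) (g s) - d (g s) (g 0)) \<longlongrightarrow> - t) at_top" by (rule tendsto_eventually)
  from tendsto_unique [OF trivial_limit_at_top_linorder tendsto_busemann [OF g(1) M] this]
  show ?thesis using horo_boundary [OF \<xi> g M] by simp
qed

lemma horo_cocycle:
  assumes \<xi>: "\<xi> \<in> closure M" and M: "x \<in> M" "y \<in> M" "z \<in> M"
  shows "horo \<xi> x y + horo \<xi> y z = horo \<xi> x z"
proof (cases "\<xi> \<in> M")
  case True
  then show ?thesis by (simp add: horo_interior commute)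
next
  case False
  then have \<xi>: "\<xi> \<in> closure M - M" using \<xi> by simp
  obtain g where g: "geodesic_ray M d g" "lands_at g \<xi>" using ex_landing_ray [OF \<xi> M(1)] by blast
  have "((\<lambda>t. (d x (g t) - d (g t) y) + (d y (g t) - d (g t) z)) \<longlongrightarrow>
      busemann d g x y + busemann d g y z) at_top"
    by (intro tendsto_add tendsto_busemann g M)
  then have "((\<lambda>t. d x (g t) - d (g t) z) \<longlongrightarrow> busemann d g x y + busemann d g y z) at_top"
    by (simp add: commute [of _ y])
  from tendsto_unique [OF trivial_limit_at_top_linorder this tendsto_busemann [OF g(1) M(1,3)]]
  show ?thesis using horo_boundary [OF \<xi> g] M by simp
qed

lemma horo_antisym:
  assumes "\<xi> \<in> closure M" "x \<in> M" "y \<in> M"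
  shows "horo \<xi> y x = - horo \<xi> x y"
  using horo_cocycle [OF assms assms(2)] horo_cocycle [OF assms(1,2,2,2)] by simp

lemma horo_le:
  assumes \<xi>: "\<xi> \<in> closure M" and M: "x \<in> M" "y \<in> M"
  shows "horo \<xi> x y \<le> d x y"
proof (cases "\<xi> \<in> M")
  case True
  then show ?thesis using triangle [OF M True] by (simp add: horo_interior commute)
next
  case False
  then have \<xi>: "\<xi> \<in> closure M - M" using \<xi> by simp
  obtain g where g: "geodesic_ray M d g" "lands_at g \<xi>" using ex_landing_ray [OF \<xi> M(1)] by blast
  have "eventually (\<lambda>t. d x (g t) - d (g t) y \<le> d x y) at_top"
    using eventually_ge_at_top [of 0]
  proof eventually_elim
    case (elim t)
    then have "g t \<in> M" using geodesic_rayD(1) [OF g(1)] by blast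
    from triangle [OF M this] show ?case by (simp add: commute)
  qed
  from tendsto_upperbound [OF tendsto_busemann [OF g(1) M] this]
  show ?thesis using horo_boundary [OF \<xi> g M] by simp
qed

lemma abs_horo_le:
  assumes "\<xi> \<in> closure M" "x \<in> M" "y \<in> M"
  shows "\<bar>horo \<xi> x y\<bar> \<le> d x y"
  using horo_le [OF assms] horo_le [OF assms(1,3,2)] horo_antisym [OF assms] commute [of x y] by simp

text \<open>
  If the bound failed for points \<open>z\<close> accumulating at \<open>\<xi>\<close>, geodesics from \<open>p\<close> to these \<open>z\<close>
  would cluster at a ray \<open>g\<close> landing at \<open>\<xi>\<close>. Choose \<open>t\<close> with \<open>d(x, g t) - t\<close> close to its
  limit \<open>B\<^sub>g(x, p)\<close>; the route from \<open>x\<close> to \<open>z\<close> through \<open>g t\<close> is then too short.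
\<close>

lemma horo_upper_limit:
  assumes \<xi>: "\<xi> \<in> closure M - M" and M: "x \<in> M" "p \<in> M" and e: "0 < e"
  shows "eventually (\<lambda>z. d x z - d z p < horo \<xi> x p + e) (at \<xi> within M)"
proof (rule ccontr)
  assume not: "\<not> ?thesis"
  define F where "F = inf (at \<xi> within M) (principal {z. \<not> d x z - d z p < horo \<xi> x p + e})"
  have nonbot: "F \<noteq> bot"
    using not unfolding F_def trivial_limit_def eventually_inf_principal by simp
  have le: "F \<le> at \<xi> within M" unfolding F_def by simp
  obtain g where g: "geodesic_ray M d g" "lands_at g \<xi>" "g 0 = p"
      and conv: "\<And>t e. \<lbrakk>0 \<le> t; 0 < e\<rbrakk> \<Longrightarrow> \<exists>\<^sub>F z in F. z \<in> M \<and> d z (g t) < d p z - t + e"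
    by (rule limit_ray [OF nonbot order_trans [OF le at_boundary(2) [OF \<xi>]]
        filter_leD [OF le at_boundary(3) [OF \<xi>]] \<xi> M(2)]) (rule that)
  have "((\<lambda>t. d x (g t) - d (g t) p) \<longlongrightarrow> horo \<xi> x p) at_top"
    using tendsto_busemann [OF g(1) M] horo_boundary [OF \<xi> g(1,2) M] by simp
  from order_tendstoD(2) [OF this, of "horo \<xi> x p + e/2"] e
  have "eventually (\<lambda>t. d x (g t) - d (g t) p < horo \<xi> x p + e/2) at_top" by simp
  then have "eventually (\<lambda>t. 0 \<le> t \<and> d x (g t) - d (g t) p < horo \<xi> x p + e/2) at_top"
    using eventually_ge_at_top [of 0] by eventually_elim simp
  then obtain t where t: "0 \<le> t" "d x (g t) - d (g t) p < horo \<xi> x p + e/2"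
    using eventually_happens by fastforce
  have gt: "g t \<in> M" "d (g t) p = t"
    using geodesic_rayD [OF g(1), of t 0] t(1) g(3) by auto
  have "eventually (\<lambda>z. \<not> d x z - d z p < horo \<xi> x p + e) F"
    unfolding F_def eventually_inf_principal by simp
  from frequently_ex [OF frequently_eventually_frequently [OF conv [OF t(1) half_gt_zero [OF e]] this]]
  obtain z where z: "z \<in> M" "d z (g t) < d p z - t + e/2" "\<not> d x z - d z p < horo \<xi> x p + e" by blast
  have "d x z \<le> d x (g t) + d z (g t)" using triangle [OF M(1) gt(1) z(1)] by (simp add: commute)
  with z t gt show False by (simp add: commute [of z p])
qed

lemma continuous_on_dist: "y \<in> M \<Longrightarrow> continuous_on M (d y)"
proof -
  assume y: "y \<in> M"
  have "continuous_map mtopology euclideanreal (\<lambda>z. d y z)"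
    using y continuous_map_mdist [of mtopology "metric (M,d)" "\<lambda>_. y" "\<lambda>z. z"] by simp
  then show ?thesis by (simp add: mtopology_eq)
qed

text \<open>
  At the boundary the lower estimate is the upper estimate with \<open>x\<close> and \<open>y\<close> exchanged, by
  antisymmetry of the cocycle.
\<close>

lemma tendsto_horo:
  assumes \<xi>: "\<xi> \<in> closure M" and M: "x \<in> M" "y \<in> M"
  shows "((\<lambda>z. horo z x y) \<longlongrightarrow> horo \<xi> x y) (at \<xi> within M)"
proof -
  have ev: "eventually (\<lambda>z. z \<in> M) (at \<xi> within M)" by (simp add: eventually_at_filter)
  have "((\<lambda>z. d x z - d z y) \<longlongrightarrow> horo \<xi> x y) (at \<xi> within M)"
  proof (cases "\<xi> \<in> M")
    case True
    have "((\<lambda>z. d x z - d y z) \<longlongrightarrow> d x \<xi> - d y \<xi>) (at \<xi> within M)"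
      using True continuous_on_dist [OF M(1)] continuous_on_dist [OF M(2)]
      by (intro tendsto_diff) (auto simp: continuous_on_def)
    then show ?thesis using True by (simp add: horo_interior commute [of _ y])
  next
    case False
    then have \<xi>': "\<xi> \<in> closure M - M" using \<xi> by simp
    show ?thesis
    proof (rule tendstoI)
      fix e :: real assume e: "0 < e"
      show "eventually (\<lambda>z. dist (d x z - d z y) (horo \<xi> x y) < e) (at \<xi> within M)"
        using horo_upper_limit [OF \<xi>' M e] horo_upper_limit [OF \<xi>' M(2,1) e]
      proof eventually_elim
        case (elim z)
        then show ?case
          using horo_antisym [OF \<xi> M] commute [of z y] commute [of x z] by (simp add: dist_real_def)
      qed
    qed
  qed
  moreover have "eventually (\<lambda>z. d x z - d z y = horo z x y) (at \<xi> within M)"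
    using ev by eventually_elim (simp add: horo_interior)
  ultimately show ?thesis by (rule Lim_transform_eventually)
qed

text \<open>
  A function on the closure that is at every point the limit of its own values on the dense
  subset \<open>M\<close> is continuous.
\<close>

lemma horo_continuous:
  assumes \<xi>: "\<xi> \<in> closure M" and M: "x \<in> M" "y \<in> M" and e: "0 < e"
  shows "\<exists>\<delta>>0. \<forall>\<eta>\<in>closure M. dist \<eta> \<xi> < \<delta> \<longrightarrow> \<bar>horo \<eta> x y - horo \<xi> x y\<bar> < e"
proof -
  have near: "\<exists>\<delta>>0. \<forall>z\<in>M. dist z \<eta> < \<delta> \<longrightarrow> \<bar>horo z x y - horo \<eta> x y\<bar> < e/2"
    if \<eta>: "\<eta> \<in> closure M" for \<eta>
  proof -
    obtain \<delta> where "0 < \<delta>" "\<forall>z\<in>M. z \<noteq> \<eta> \<and> dist z \<eta> < \<delta> \<longrightarrow> dist (horo z x y) (horo \<eta> x y) < e/2"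
      using tendstoD [OF tendsto_horo [OF \<eta> M] half_gt_zero [OF e]] unfolding eventually_at by blast
    then show ?thesis using e by (intro exI [of _ \<delta>]) (auto simp: dist_real_def)
  qed
  obtain \<delta> where \<delta>: "0 < \<delta>" "\<forall>z\<in>M. dist z \<xi> < \<delta> \<longrightarrow> \<bar>horo z x y - horo \<xi> x y\<bar> < e/2"
    using near [OF \<xi>] by blast
  have "\<bar>horo \<eta> x y - horo \<xi> x y\<bar> < e" if \<eta>: "\<eta> \<in> closure M" "dist \<eta> \<xi> < \<delta>" for \<eta>
  proof -
    obtain \<delta>' where \<delta>': "0 < \<delta>'" "\<forall>z\<in>M. dist z \<eta> < \<delta>' \<longrightarrow> \<bar>horo z x y - horo \<eta> x y\<bar> < e/2"
      using near [OF \<eta>(1)] by blast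
    have "0 < min \<delta>' (\<delta> - dist \<eta> \<xi>)" using \<delta>'(1) \<eta>(2) by simp
    then obtain z where z: "z \<in> M" "dist z \<eta> < min \<delta>' (\<delta> - dist \<eta> \<xi>)"
      using \<eta>(1) unfolding closure_approachable by blast
    then have "dist z \<xi> < \<delta>" using dist_triangle [of z \<xi> \<eta>] by simp
    then have "\<bar>horo z x y - horo \<xi> x y\<bar> < e/2" "\<bar>horo z x y - horo \<eta> x y\<bar> < e/2"
      using \<delta>(2) \<delta>'(2) z by auto
    then show ?thesis by linarith
  qed
  with \<delta>(1) show ?thesis by blast
qed

text \<open>
  All the functions are 1-Lipschitz, so convergence on a finite net of \<open>K\<close> is uniform on \<open>K\<close>.
\<close>

lemma horo_uniformly_continuous:
  assumes \<xi>: "\<xi> \<in> closure M" and p: "p \<in> M" and K: "compactin mtopology K" and e: "0 < e"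
  shows "\<exists>\<delta>>0. \<forall>\<eta>\<in>closure M. dist \<eta> \<xi> < \<delta> \<longrightarrow> (\<forall>x\<in>K. \<bar>horo \<eta> x p - horo \<xi> x p\<bar> < e)"
proof -
  have KM: "K \<subseteq> M" using compactin_subset_topspace [OF K] by simp
  obtain N where N: "finite N" "N \<subseteq> K" "K \<subseteq> (\<Union>k\<in>N. mball k (e/3))"
    by (rule compactin_finite_net [OF K, of "e/3"]) (use e in simp)
  have "\<forall>n\<in>N. \<exists>\<delta>>0. \<forall>\<eta>\<in>closure M. dist \<eta> \<xi> < \<delta> \<longrightarrow> \<bar>horo \<eta> n p - horo \<xi> n p\<bar> < e/3"
    using horo_continuous [OF \<xi> _ p, of _ "e/3"] e N(2) KM by auto
  then obtain \<delta> where \<delta>: "\<forall>n\<in>N. 0 < \<delta> n \<and>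
      (\<forall>\<eta>\<in>closure M. dist \<eta> \<xi> < \<delta> n \<longrightarrow> \<bar>horo \<eta> n p - horo \<xi> n p\<bar> < e/3)"
    by metis
  define \<delta>0 where "\<delta>0 = Min (insert 1 (\<delta> ` N))"
  have "0 < \<delta>0" unfolding \<delta>0_def using N(1) \<delta> by (subst Min_gr_iff) auto
  moreover have "\<bar>horo \<eta> x p - horo \<xi> x p\<bar> < e"
    if \<eta>: "\<eta> \<in> closure M" "dist \<eta> \<xi> < \<delta>0" and x: "x \<in> K" for \<eta> x
  proof -
    obtain n where n: "n \<in> N" "n \<in> M" "x \<in> M" "d n x < e/3" using N(3) x by auto
    have "\<delta>0 \<le> \<delta> n" unfolding \<delta>0_def using N(1) n(1) by (intro Min_le) auto
    then have "\<bar>horo \<eta> n p - horo \<xi> n p\<bar> < e/3" using \<delta> n(1) \<eta> by auto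
    moreover have "\<bar>horo \<zeta> n x\<bar> < e/3" if "\<zeta> \<in> closure M" for \<zeta>
      using abs_horo_le [OF that n(2,3)] n(4) by simp
    from this [OF \<xi>] this [OF \<eta>(1)] have "\<bar>horo \<xi> n x\<bar> < e/3" "\<bar>horo \<eta> n x\<bar> < e/3" .
    moreover have "horo \<zeta> n p = horo \<zeta> n x + horo \<zeta> x p" if "\<zeta> \<in> closure M" for \<zeta>
      using horo_cocycle [OF that n(2,3) p] by simp
    from this [OF \<xi>] this [OF \<eta>(1)]
    have "horo \<xi> n p = horo \<xi> n x + horo \<xi> x p" "horo \<eta> n p = horo \<eta> n x + horo \<eta> x p" .
    ultimately show ?thesis by linarith
  qed
  ultimately show ?thesis by blast
qed

text \<open>
  This is \<open>separation\<close> with \<open>z\<close> moved to the boundary; halving the radius keeps the points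
  \<open>z\<close> near \<open>\<eta>\<close> away from \<open>\<xi>\<close>.
\<close>

lemma horo_lower_bound:
  assumes \<xi>: "\<xi> \<in> closure M - M" and r: "0 < r" and p: "p \<in> M"
  shows "\<exists>\<delta>>0. \<exists>R. \<forall>y\<in>M. \<forall>\<eta>\<in>closure M. dist y \<xi> < \<delta> \<longrightarrow> r \<le> dist \<eta> \<xi> \<longrightarrow>
    d p y - 2 * R \<le> horo \<eta> y p"
proof -
  obtain \<delta> R where \<delta>: "0 < \<delta>" and R: "\<And>y z. \<lbrakk>y \<in> M; z \<in> M; dist y \<xi> < \<delta>; r/2 \<le> dist z \<xi>\<rbrakk> \<Longrightarrow>
      d p y + d p z - 2 * R \<le> d y z"
    using separation [OF \<xi> half_gt_zero [OF r] p] by blast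
  have "d p y - 2 * R \<le> horo \<eta> y p"
    if y: "y \<in> M" "dist y \<xi> < \<delta>" and \<eta>: "\<eta> \<in> closure M" "r \<le> dist \<eta> \<xi>" for y \<eta>
  proof -
    have bound: "d p y - 2 * R \<le> horo z y p" if "z \<in> M" "r/2 \<le> dist z \<xi>" for z
      using R [OF y(1) that(1) y(2) that(2)] that(1) by (simp add: horo_interior commute [of z p])
    show ?thesis
    proof (cases "\<eta> \<in> M")
      case True
      then show ?thesis using bound \<eta>(2) r by simp
    next
      case False
      then have \<eta>': "\<eta> \<in> closure M - M" using \<eta> by simp
      have "eventually (\<lambda>z. dist z \<eta> < r/2) (at \<eta> within M)"
        using r unfolding eventually_at by (intro exI [of _ "r/2"]) auto
      with at_boundary(3) [OF \<eta>'] have "eventually (\<lambda>z. d p y - 2 * R \<le> horo z y p) (at \<eta> within M)"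
      proof eventually_elim
        case (elim z)
        have "r/2 \<le> dist z \<xi>" using elim(2) \<eta>(2) dist_triangle [of \<eta> \<xi> z] by (simp add: dist_commute)
        then show ?case using bound elim(1) by blast
      qed
      then show ?thesis
        by (rule tendsto_lowerbound [OF tendsto_horo [OF \<eta>(1) y(1) p] _ at_boundary(1) [OF \<eta>']])
    qed
  qed
  with \<delta> show ?thesis by blast
qed

text \<open>
  The point \<open>x\<close> is taken on a ray from \<open>p\<close> landing at \<open>\<xi>\<close>, at a time \<open>t \<ge> R + 1\<close>: there the
  value for \<open>\<xi>\<close> is \<open>- t\<close> and the value for a distant \<open>\<eta>\<close> is at least \<open>t - 2 R\<close>, so the two
  differ by at least 2.
\<close>

lemma horo_identifies_boundary_point:
  assumes \<xi>: "\<xi> \<in> closure M - M" and r: "0 < r" and p: "p \<in> M"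
  shows "\<exists>x\<in>M. \<forall>\<eta>\<in>closure M. \<bar>horo \<eta> x p - horo \<xi> x p\<bar> < 1 \<longrightarrow> dist \<eta> \<xi> < r"
proof -
  obtain \<delta> R where \<delta>: "0 < \<delta>" and R: "\<And>y \<eta>. \<lbrakk>y \<in> M; \<eta> \<in> closure M; dist y \<xi> < \<delta>; r \<le> dist \<eta> \<xi>\<rbrakk> \<Longrightarrow>
      d p y - 2 * R \<le> horo \<eta> y p"
    using horo_lower_bound [OF \<xi> r p] by blast
  obtain g where g: "geodesic_ray M d g" "lands_at g \<xi>" "g 0 = p"
    using ex_landing_ray [OF \<xi> p] by blast
  have "eventually (\<lambda>t. dist (g t) \<xi> < \<delta>) at_top"
    using tendstoD [OF g(2) [unfolded lands_at_def] \<delta>] .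
  then have "eventually (\<lambda>t. max 0 (R + 1) \<le> t \<and> dist (g t) \<xi> < \<delta>) at_top"
    using eventually_ge_at_top [of "max 0 (R + 1)"] by eventually_elim simp
  then obtain t where t: "0 \<le> t" "R + 1 \<le> t" "dist (g t) \<xi> < \<delta>"
    using eventually_happens by fastforce
  have gt: "g t \<in> M" "d p (g t) = t"
    using geodesic_rayD [OF g(1) t(1), of 0] g(3) t(1) by (auto simp: commute)
  have "dist \<eta> \<xi> < r" if \<eta>: "\<eta> \<in> closure M" and less: "\<bar>horo \<eta> (g t) p - horo \<xi> (g t) p\<bar> < 1" for \<eta>
  proof (rule ccontr)
    assume "\<not> dist \<eta> \<xi> < r"
    then have "t - 2 * R \<le> horo \<eta> (g t) p" using R [OF gt(1) \<eta> t(3)] gt(2) by simp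
    moreover have "horo \<xi> (g t) p = - t" using horo_along_ray [OF \<xi> g(1,2) t(1)] g(3) by simp
    ultimately show False using less t by linarith
  qed
  with gt(1) show ?thesis by blast
qed

text \<open>
  Move by \<open>e\<close> from \<open>p\<close> towards \<open>\<eta>\<close>, along a segment or a ray.
\<close>

lemma horo_descends:
  assumes \<eta>: "\<eta> \<in> closure M" and p: "p \<in> M" and e: "0 < e" and far: "\<eta> \<notin> mball p e"
  shows "\<exists>z\<in>M. d p z = e \<and> horo \<eta> z p = - e"
proof (cases "\<eta> \<in> M")
  case True
  with far p have le: "e \<le> d p \<eta>" by auto
  obtain \<gamma> where \<gamma>: "geodesic_segment M d 0 (d p \<eta>) \<gamma>" "\<gamma> 0 = p" "\<gamma> (d p \<eta>) = \<eta>"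
    using geodesic [OF p True] by blast
  have I: "0 \<in> {0..d p \<eta>}" "e \<in> {0..d p \<eta>}" "d p \<eta> \<in> {0..d p \<eta>}" using le e by auto
  have "d p (\<gamma> e) = e" "d (\<gamma> e) \<eta> = d p \<eta> - e" "\<gamma> e \<in> M"
    using geodesic_segmentD [OF \<gamma>(1) I(2,1)] geodesic_segmentD [OF \<gamma>(1) I(2,3)] \<gamma>(2,3) e le
    by (auto simp: commute)
  then show ?thesis using True by (intro bexI [of _ "\<gamma> e"]) (auto simp: horo_interior commute)
next
  case False
  then have \<eta>: "\<eta> \<in> closure M - M" using \<eta> by simp
  obtain g where g: "geodesic_ray M d g" "lands_at g \<eta>" "g 0 = p"
    using ex_landing_ray [OF \<eta> p] by blast
  have "g e \<in> M" "d p (g e) = e"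
    using geodesic_rayD [OF g(1), of e 0] g(3) e by (auto simp: commute)
  moreover have "horo \<eta> (g e) p = - e" using horo_along_ray [OF \<eta> g(1,2)] g(3) e by simp
  ultimately show ?thesis by blast
qed

text \<open>
  For \<open>\<xi>\<close> in \<open>M\<close> take a closed ball of radius \<open>e\<close> about \<open>\<xi>\<close>. On its sphere the cocycle of
  \<open>\<xi>\<close>, normalised at \<open>\<xi>\<close>, equals \<open>e\<close>, while that of a point \<open>\<eta>\<close> outside the ball takes the
  value \<open>- e\<close> somewhere. The tolerance is \<open>e/2\<close> because changing the normalisation from \<open>p\<close> to
  \<open>\<xi>\<close> uses it twice.
\<close>

lemma horo_identifies_point:
  assumes \<xi>: "\<xi> \<in> closure M" and r: "0 < r" and p: "p \<in> M"
  shows "\<exists>K e. compactin mtopology K \<and> 0 < e \<and>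
    (\<forall>\<eta>\<in>closure M. (\<forall>x\<in>K. \<bar>horo \<eta> x p - horo \<xi> x p\<bar> < e) \<longrightarrow> dist \<eta> \<xi> < r)"
proof (cases "\<xi> \<in> M")
  case False
  then have "\<xi> \<in> closure M - M" using \<xi> by simp
  then obtain x where "x \<in> M" "\<forall>\<eta>\<in>closure M. \<bar>horo \<eta> x p - horo \<xi> x p\<bar> < 1 \<longrightarrow> dist \<eta> \<xi> < r"
    using horo_identifies_boundary_point [OF _ r p] by blast
  then show ?thesis by (intro exI [of _ "{x}"] exI [of _ 1]) auto
next
  case True
  have "openin mtopology (M \<inter> ball \<xi> r)" unfolding mtopology_eq by (simp add: openin_open_Int)
  moreover have "\<xi> \<in> M \<inter> ball \<xi> r" using True r by simp
  ultimately obtain e where e: "0 < e" "mball \<xi> e \<subseteq> M \<inter> ball \<xi> r"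
    unfolding openin_mtopology by blast
  have "dist \<eta> \<xi> < r" if \<eta>: "\<eta> \<in> closure M"
    and close: "\<forall>x\<in>mcball \<xi> e. \<bar>horo \<eta> x p - horo \<xi> x p\<bar> < e/2" for \<eta>
  proof (rule ccontr)
    assume "\<not> dist \<eta> \<xi> < r"
    then have "\<eta> \<notin> mball \<xi> e" using e(2) by (auto simp: dist_commute)
    then obtain z where z: "z \<in> M" "d \<xi> z = e" "horo \<eta> z \<xi> = - e"
      using horo_descends [OF \<eta> True e(1)] by blast
    have "\<bar>horo \<eta> z p - horo \<xi> z p\<bar> < e/2" "\<bar>horo \<eta> \<xi> p - horo \<xi> \<xi> p\<bar> < e/2"
      using close z True e(1) by auto
    moreover have "horo \<xi> z \<xi> = e" using z True by (simp add: horo_interior commute)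
    ultimately show False
      using z(3) horo_cocycle [OF \<eta> z(1) True p] horo_cocycle [OF \<xi> z(1) True p] e(1) by linarith
  qed
  then show ?thesis using proper e(1) by (intro exI [of _ "mcball \<xi> e"] exI [of _ "e/2"]) auto
qed

end

section \<open>Topology of functions modulo constants\<close>

text \<open>
  The third hypothesis says that the topology of \<open>X\<close> is coarser than the one pulled back
  along \<open>f\<close>; together with the Hausdorff property it also yields injectivity.
\<close>

lemma embedding_map_from_separating_neighbourhoods:
  assumes cont: "continuous_map X Y f" and haus: "Hausdorff_space X"
    and sep: "\<And>U x. \<lbrakk>openin X U; x \<in> U\<rbrakk> \<Longrightarrow>
      \<exists>V. openin Y V \<and> f x \<in> V \<and> (\<forall>y\<in>topspace X. f y \<in> V \<longrightarrow> y \<in> U)"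
  shows "embedding_map X Y f"
proof -
  have inj: "inj_on f (topspace X)"
  proof (rule inj_onI, rule ccontr)
    fix x y assume xy: "x \<in> topspace X" "y \<in> topspace X" "f x = f y" "x \<noteq> y"
    then obtain U W where U: "openin X U" "openin X W" "x \<in> U" "y \<in> W" "disjnt U W"
      using haus unfolding Hausdorff_space_def by metis
    then obtain V where "f x \<in> V" "\<forall>y\<in>topspace X. f y \<in> V \<longrightarrow> y \<in> U" using sep [OF U(1,3)] by blast
    with xy have "y \<in> U" by simp
    with U show False by (auto simp: disjnt_def)
  qed
  have "open_map X (subtopology Y (f ` topspace X)) f"
    unfolding open_map_def
  proof (intro allI impI)
    fix U assume U: "openin X U"
    let ?\<V> = "{V. openin Y V \<and> (\<forall>y\<in>topspace X. f y \<in> V \<longrightarrow> y \<in> U)}"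
    have "f ` U = \<Union>?\<V> \<inter> f ` topspace X"
    proof (intro subset_antisym subsetI)
      fix v assume "v \<in> f ` U"
      then obtain x where x: "x \<in> U" "v = f x" by blast
      obtain V where "openin Y V" "f x \<in> V" "\<forall>y\<in>topspace X. f y \<in> V \<longrightarrow> y \<in> U"
        using sep [OF U x(1)] by blast
      then show "v \<in> \<Union>?\<V> \<inter> f ` topspace X" using x openin_subset [OF U] by blast
    qed blast
    moreover have "openin Y (\<Union>?\<V>)" by (rule openin_Union) simp
    ultimately show "openin (subtopology Y (f ` topspace X)) (f ` U)"
      unfolding openin_subtopology by blast
  qed
  moreover have "continuous_map X (subtopology Y (f ` topspace X)) f"
    using cont by (simp add: continuous_map_in_subtopology)
  ultimately have "embedding_map X (subtopology Y (f ` topspace X)) f"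
    using inj by (intro injective_open_imp_embedding_map)
  then show ?thesis by (simp add: embedding_map_in_subtopology)
qed

text \<open>
  The bound \<open>r < e\<close> is uniform over \<open>K\<close>, so openness is the triangle inequality with the
  remaining room \<open>e - r\<close>.
\<close>

definition uniform_nbhd :: "'a topology \<Rightarrow> ('a \<Rightarrow> real) \<Rightarrow> 'a set \<Rightarrow> real \<Rightarrow> ('a \<Rightarrow> real) set" where
  "uniform_nbhd X f K e = {g \<in> cfuns X. \<exists>r<e. \<forall>x\<in>K. \<bar>g x - f x\<bar> \<le> r}"

lemma openin_uniform_nbhd:
  assumes K: "compactin X K"
  shows "openin (compact_convergence X) (uniform_nbhd X f K e)"
  unfolding openin_compact_convergence
proof (intro conjI ballI)
  show "uniform_nbhd X f K e \<subseteq> cfuns X" by (auto simp: uniform_nbhd_def)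
  fix g assume "g \<in> uniform_nbhd X f K e"
  then obtain r where r: "r < e" "\<forall>x\<in>K. \<bar>g x - f x\<bar> \<le> r" by (auto simp: uniform_nbhd_def)
  have "{h \<in> cfuns X. \<forall>x\<in>K. \<bar>h x - g x\<bar> < (e - r)/2} \<subseteq> uniform_nbhd X f K e"
  proof
    fix h assume h: "h \<in> {h \<in> cfuns X. \<forall>x\<in>K. \<bar>h x - g x\<bar> < (e - r)/2}"
    have "\<bar>h x - f x\<bar> \<le> (e + r)/2" if "x \<in> K" for x
    proof -
      have "\<bar>h x - g x\<bar> < (e - r)/2" "\<bar>g x - f x\<bar> \<le> r" using h r(2) that by auto
      moreover have "\<bar>h x - f x\<bar> \<le> \<bar>h x - g x\<bar> + \<bar>g x - f x\<bar>" by simp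
      moreover have "(e + r)/2 = (e - r)/2 + r" by (simp add: field_simps)
      ultimately show ?thesis by linarith
    qed
    moreover have "(e + r)/2 < e" using r(1) by simp
    ultimately show "h \<in> uniform_nbhd X f K e" using h unfolding uniform_nbhd_def by blast
  qed
  then show "\<exists>L s. compactin X L \<and> 0 < s \<and>
      {h \<in> cfuns X. \<forall>x\<in>L. \<bar>h x - g x\<bar> < s} \<subseteq> uniform_nbhd X f K e"
    using K r(1) by (intro exI [of _ K] exI [of _ "(e - r)/2"]) simp
qed

definition normalised :: "'a topology \<Rightarrow> 'a \<Rightarrow> ('a \<Rightarrow> real) \<Rightarrow> 'a \<Rightarrow> real" where
  "normalised X p f = restrict (\<lambda>x. f x - f p) (topspace X)"

lemma normalised_in_cfuns:
  assumes "f \<in> cfuns X"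
  shows "normalised X p f \<in> cfuns X"
proof -
  have "continuous_map X euclideanreal (\<lambda>x. f x - f p)"
    using assms by (intro continuous_map_diff) (auto simp: cfuns_def)
  then have "continuous_map X euclideanreal (normalised X p f)"
    by (rule continuous_map_eq) (simp add: normalised_def)
  then show ?thesis by (simp add: cfuns_def normalised_def)
qed

lemma continuous_map_normalised:
  assumes p: "p \<in> topspace X"
  shows "continuous_map (compact_convergence X) (compact_convergence X) (normalised X p)"
  unfolding continuous_map_def
proof (intro conjI allI impI)
  show "normalised X p \<in> topspace (compact_convergence X) \<rightarrow> topspace (compact_convergence X)"
    by (simp add: normalised_in_cfuns)
  fix U assume U: "openin (compact_convergence X) U"
  show "openin (compact_convergence X) {f \<in> topspace (compact_convergence X). normalised X p f \<in> U}"
    unfolding openin_compact_convergence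
  proof (intro conjI ballI)
    fix f assume "f \<in> {f \<in> topspace (compact_convergence X). normalised X p f \<in> U}"
    then have f: "f \<in> cfuns X" "normalised X p f \<in> U" by auto
    obtain K e where K: "compactin X K" "0 < e"
      "{g \<in> cfuns X. \<forall>x\<in>K. \<bar>g x - normalised X p f x\<bar> < e} \<subseteq> U"
      using U f(2) unfolding openin_compact_convergence by blast
    have "{g \<in> cfuns X. \<forall>x\<in>insert p K. \<bar>g x - f x\<bar> < e/2} \<subseteq>
        {g \<in> topspace (compact_convergence X). normalised X p g \<in> U}"
    proof
      fix g assume g: "g \<in> {g \<in> cfuns X. \<forall>x\<in>insert p K. \<bar>g x - f x\<bar> < e/2}"
      have "\<bar>normalised X p g x - normalised X p f x\<bar> < e" if x: "x \<in> K" for x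
      proof -
        have "\<bar>g x - f x\<bar> < e/2" "\<bar>g p - f p\<bar> < e/2" using g x by auto
        moreover have "x \<in> topspace X" using x compactin_subset_topspace [OF K(1)] by blast
        then have "normalised X p g x - normalised X p f x = (g x - f x) - (g p - f p)"
          by (simp add: normalised_def)
        moreover have "\<bar>(g x - f x) - (g p - f p)\<bar> \<le> \<bar>g x - f x\<bar> + \<bar>g p - f p\<bar>"
          by (rule abs_triangle_ineq4)
        ultimately show ?thesis by linarith
      qed
      then show "g \<in> {g \<in> topspace (compact_convergence X). normalised X p g \<in> U}"
        using g K(3) normalised_in_cfuns [of g X p] by auto
    qed
    moreover have "compactin X (insert p K)"
      using compactin_Un [of X "{p}" K] K(1) p by simp
    ultimately show "\<exists>L s. compactin X L \<and> 0 < s \<and> {g \<in> cfuns X. \<forall>x\<in>L. \<bar>g x - f x\<bar> < s} \<subseteq>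
        {g \<in> topspace (compact_convergence X). normalised X p g \<in> U}"
      using K(2) by (intro exI [of _ "insert p K"] exI [of _ "e/2"]) simp
  qed auto
qed

text \<open>
  A continuous section of the quotient map modulo constants. Through it, questions about
  neighbourhoods of a class become questions about uniform convergence of normalised
  functions.
\<close>

definition representative :: "'a topology \<Rightarrow> 'a \<Rightarrow> ('a \<Rightarrow> real) set \<Rightarrow> 'a \<Rightarrow> real" where
  "representative X p c = normalised X p (SOME f. f \<in> c)"

lemma representative_mod_const:
  assumes f: "f \<in> cfuns X" and p: "p \<in> topspace X"
  shows "representative X p (mod_const X f) = normalised X p f"
proof -
  have "f \<in> mod_const X f" using f unfolding mod_const_def by (auto intro: exI [of _ 0])
  then have "(SOME g. g \<in> mod_const X f) \<in> mod_const X f"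
    by (rule someI [of "\<lambda>g. g \<in> mod_const X f"])
  then obtain c where "\<forall>x\<in>topspace X. (SOME g. g \<in> mod_const X f) x = f x + c"
    unfolding mod_const_def by blast
  then show ?thesis unfolding representative_def normalised_def using p by (intro restrict_ext) simp
qed

lemma continuous_map_representative:
  assumes p: "p \<in> topspace X"
  shows "continuous_map (cstar_topology X) (compact_convergence X) (representative X p)"
proof (rule continuous_compose_quotient_map [OF quotient_map_mod_const])
  show "continuous_map (compact_convergence X) (compact_convergence X) (representative X p \<circ> mod_const X)"
    by (rule continuous_map_eq [OF continuous_map_normalised [OF p]])
      (simp add: representative_mod_const p)
qed


section \<open>The embedding theorem for visibility spaces\<close>

context visibility_space
begin

definition horofunction :: "'a \<Rightarrow> 'a \<Rightarrow> 'a \<Rightarrow> real" where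
  "horofunction p \<xi> = restrict (\<lambda>x. horo \<xi> x p) M"

lemma horofunction_in_cfuns:
  assumes "\<xi> \<in> closure M" "p \<in> M"
  shows "horofunction p \<xi> \<in> cfuns mtopology"
proof -
  have "continuous_map mtopology euclideanreal (\<lambda>x. horo \<xi> x p)"
    unfolding mtopology_eq continuous_map_iff_continuous continuous_on_iff
  proof (intro ballI allI impI)
    fix x and e :: real assume x: "x \<in> M" and e: "0 < e"
    obtain \<delta> where \<delta>: "0 < \<delta>" "\<forall>y\<in>M. dist y x < \<delta> \<longrightarrow> dist (d x y) (d x x) < e"
      using continuous_on_dist [OF x] x e unfolding continuous_on_iff by blast
    have "dist (horo \<xi> y p) (horo \<xi> x p) < e" if y: "y \<in> M" "dist y x < \<delta>" for y
    proof -
      have "d x y < e" using \<delta>(2) y x by simp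
      then show ?thesis
        using abs_horo_le [OF assms(1) x y(1)] horo_cocycle [OF assms(1) x y(1) assms(2)]
        by (simp add: dist_real_def)
    qed
    with \<delta>(1) show "\<exists>\<delta>>0. \<forall>y\<in>M. dist y x < \<delta> \<longrightarrow> dist (horo \<xi> y p) (horo \<xi> x p) < e" by blast
  qed
  then have "continuous_map mtopology euclideanreal (horofunction p \<xi>)"
    by (rule continuous_map_eq) (simp add: horofunction_def)
  then show ?thesis unfolding cfuns_def by (simp add: horofunction_def)
qed

lemma continuous_map_horofunction:
  assumes p: "p \<in> M"
  shows "continuous_map (top_of_set (closure M)) (compact_convergence mtopology) (horofunction p)"
  unfolding continuous_map_def
proof (intro conjI allI impI)
  show "horofunction p \<in> topspace (top_of_set (closure M)) \<rightarrow> topspace (compact_convergence mtopology)"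
    using horofunction_in_cfuns p by simp
  fix U assume U: "openin (compact_convergence mtopology) U"
  show "openin (top_of_set (closure M)) {\<xi> \<in> topspace (top_of_set (closure M)). horofunction p \<xi> \<in> U}"
    unfolding openin_euclidean_subtopology_iff
  proof (intro conjI ballI)
    fix \<xi> assume "\<xi> \<in> {\<xi> \<in> topspace (top_of_set (closure M)). horofunction p \<xi> \<in> U}"
    then have \<xi>: "\<xi> \<in> closure M" "horofunction p \<xi> \<in> U" by auto
    obtain K e where K: "compactin mtopology K" "0 < e"
      "{g \<in> cfuns mtopology. \<forall>x\<in>K. \<bar>g x - horofunction p \<xi> x\<bar> < e} \<subseteq> U"
      using U \<xi>(2) unfolding openin_compact_convergence by blast
    have KM: "K \<subseteq> M" using compactin_subset_topspace [OF K(1)] by simp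
    obtain \<delta> where \<delta>: "0 < \<delta>"
      "\<forall>\<eta>\<in>closure M. dist \<eta> \<xi> < \<delta> \<longrightarrow> (\<forall>x\<in>K. \<bar>horo \<eta> x p - horo \<xi> x p\<bar> < e)"
      using horo_uniformly_continuous [OF \<xi>(1) p K(1,2)] by blast
    have "horofunction p \<eta> \<in> U" if \<eta>: "\<eta> \<in> closure M" "dist \<eta> \<xi> < \<delta>" for \<eta>
    proof -
      have "\<bar>horofunction p \<eta> x - horofunction p \<xi> x\<bar> < e" if "x \<in> K" for x
        using \<delta>(2) \<eta> that KM by (auto simp: horofunction_def)
      then show ?thesis using K(3) horofunction_in_cfuns [OF \<eta>(1) p] by blast
    qed
    with \<delta>(1) show "\<exists>e>0. \<forall>\<eta>\<in>closure M. dist \<eta> \<xi> < e \<longrightarrow>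
        \<eta> \<in> {\<xi> \<in> topspace (top_of_set (closure M)). horofunction p \<xi> \<in> U}"
      by (intro exI [of _ \<delta>]) simp
  qed auto
qed

text \<open>
  A neighbourhood of \<open>\<xi>\<close> is recognised by approximate values on a compact set
  (\<open>horo_identifies_point\<close>), and the classes whose normalised representative has nearly these
  values form an open set.
\<close>

lemma horofunction_class_embedding:
  assumes p: "p \<in> M"
  shows "embedding_map (top_of_set (closure M)) (cstar_topology mtopology)
    (\<lambda>\<xi>. mod_const mtopology (horofunction p \<xi>))"
proof (rule embedding_map_from_separating_neighbourhoods)
  show "continuous_map (top_of_set (closure M)) (cstar_topology mtopology)
      (\<lambda>\<xi>. mod_const mtopology (horofunction p \<xi>))"
    using continuous_map_compose [OF continuous_map_horofunction [OF p]
        quotient_imp_continuous_map [OF quotient_map_mod_const]]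
    by (simp add: o_def)
  show "Hausdorff_space (top_of_set (closure M))"
    by (simp add: Hausdorff_space_subtopology)
  fix U \<xi> assume U: "openin (top_of_set (closure M)) U" "\<xi> \<in> U"
  then have \<xi>: "\<xi> \<in> closure M" using openin_subset [OF U(1)] by auto
  obtain r where r: "0 < r" "\<forall>\<eta>\<in>closure M. dist \<eta> \<xi> < r \<longrightarrow> \<eta> \<in> U"
    using U unfolding openin_euclidean_subtopology_iff by blast
  obtain K e where K: "compactin mtopology K" "0 < e"
    "\<forall>\<eta>\<in>closure M. (\<forall>x\<in>K. \<bar>horo \<eta> x p - horo \<xi> x p\<bar> < e) \<longrightarrow> dist \<eta> \<xi> < r"
    using horo_identifies_point [OF \<xi> r(1) p] by blast
  have KM: "K \<subseteq> M" using compactin_subset_topspace [OF K(1)] by simp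
  let ?W = "uniform_nbhd mtopology (horofunction p \<xi>) K e"
  let ?V = "{c \<in> topspace (cstar_topology mtopology). representative mtopology p c \<in> ?W}"
  have rep: "representative mtopology p (mod_const mtopology (horofunction p \<eta>)) = horofunction p \<eta>"
    if "\<eta> \<in> closure M" for \<eta>
  proof -
    have "horo \<eta> p p = 0" using abs_horo_le [OF that p p] p by simp
    then have "normalised mtopology p (horofunction p \<eta>) = horofunction p \<eta>"
      using p by (auto simp: normalised_def horofunction_def)
    then show ?thesis
      using representative_mod_const [OF horofunction_in_cfuns [OF that p]] p by simp
  qed
  have "openin (cstar_topology mtopology) ?V"
    using openin_continuous_map_preimage [OF continuous_map_representative openin_uniform_nbhd [OF K(1)]]
      p by simp
  moreover have "mod_const mtopology (horofunction p \<xi>) \<in> ?V"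
    using horofunction_in_cfuns [OF \<xi> p] rep [OF \<xi>] K(2)
    by (auto simp: uniform_nbhd_def intro: exI [of _ 0])
  moreover have "\<eta> \<in> U"
    if \<eta>: "\<eta> \<in> closure M" and V: "mod_const mtopology (horofunction p \<eta>) \<in> ?V" for \<eta>
  proof -
    have "horofunction p \<eta> \<in> ?W" using V rep [OF \<eta>] by simp
    then obtain s where s: "s < e" "\<forall>x\<in>K. \<bar>horofunction p \<eta> x - horofunction p \<xi> x\<bar> \<le> s"
      unfolding uniform_nbhd_def by blast
    have "\<bar>horo \<eta> x p - horo \<xi> x p\<bar> < e" if "x \<in> K" for x
      using bspec [OF s(2) that] s(1) subsetD [OF KM that] by (simp add: horofunction_def)
    then show ?thesis using K(3) r(2) \<eta> by blast
  qed
  ultimately show "\<exists>V. openin (cstar_topology mtopology) V \<and> mod_const mtopology (horofunction p \<xi>) \<in> V \<and>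
      (\<forall>\<eta>\<in>topspace (top_of_set (closure M)). mod_const mtopology (horofunction p \<eta>) \<in> V \<longrightarrow> \<eta> \<in> U)"
    by (intro exI [of _ ?V] conjI) auto
qed

text \<open>
  That Busemann functions are limits of distance functions is part of the continuity of \<open>P\<close>:
  \<open>M\<close> is dense in its closure, so the image of the closure lies in the closure of the image of
  \<open>M\<close>.
\<close>

theorem closure_embeds_in_horofunction_compactification:
  assumes interior: "\<And>\<xi>. \<xi> \<in> M \<Longrightarrow> P \<xi> = mod_const mtopology (\<lambda>z. d z \<xi>)"
    and boundary: "\<And>\<xi> \<gamma>. \<lbrakk>\<xi> \<in> closure M - M; geodesic_ray M d \<gamma>; lands_at \<gamma> \<xi>\<rbrakk> \<Longrightarrow>
      P \<xi> = busemann_class M d \<gamma>"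
    and ne: "M \<noteq> {}"
  shows "P ` closure M \<subseteq> topspace (horofunction_compactification M d)"
    and "embedding_map (top_of_set (closure M)) (horofunction_compactification M d) P"
proof -
  obtain p where p: "p \<in> M" using ne by blast
  have P: "mod_const mtopology (horofunction p \<xi>) = P \<xi>" if \<xi>: "\<xi> \<in> closure M" for \<xi>
  proof (cases "\<xi> \<in> M")
    case True
    have "mod_const mtopology (horofunction p \<xi>) = mod_const mtopology (\<lambda>z. d z \<xi>)"
      by (rule mod_const_eqI [of _ _ _ "- d \<xi> p"]) (simp add: horofunction_def horo_interior True)
    then show ?thesis using interior [OF True] by simp
  next
    case False
    then have \<xi>': "\<xi> \<in> closure M - M" using \<xi> by simp
    obtain g where g: "geodesic_ray M d g" "lands_at g \<xi>" using ex_landing_ray [OF \<xi>' p] by blast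
    have "mod_const mtopology (horofunction p \<xi>) = mod_const mtopology (\<lambda>x. busemann d g x p)"
      by (rule mod_const_eqI [of _ _ _ 0]) (simp add: horofunction_def horo_boundary [OF \<xi>' g _ p])
    then show ?thesis using busemann_class_basepoint [OF g(1) p] boundary [OF \<xi>' g] by simp
  qed
  have emb: "embedding_map (top_of_set (closure M)) (cstar_topology mtopology) P"
    by (rule embedding_map_eq [OF horofunction_class_embedding [OF p]]) (simp add: P)
  have "continuous_map (top_of_set (closure M)) (cstar_topology mtopology) P"
    using homeomorphic_imp_continuous_map [OF emb [unfolded embedding_map_def]]
    by (simp only: continuous_map_in_subtopology)
  from continuous_map_image_closure_subset [OF this, of M]
  have "P ` (top_of_set (closure M) closure_of M) \<subseteq> cstar_topology mtopology closure_of (P ` M)" .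
  moreover have "top_of_set (closure M) closure_of M = closure M"
    by (simp add: closure_of_subtopology Int_absorb1 closure_subset)
  ultimately have "P ` closure M \<subseteq> cstar_topology mtopology closure_of (P ` M)" by simp
  moreover have "P ` M = horo_map M d ` M"
    by (rule image_cong) (auto simp: interior horo_map_def commute)
  ultimately have sub: "P ` closure M \<subseteq> cstar_topology mtopology closure_of (horo_map M d ` M)" by simp
  then show "P ` closure M \<subseteq> topspace (horofunction_compactification M d)"
    unfolding horofunction_compactification_def Let_def
    using closure_of_subset_topspace [of "cstar_topology mtopology"] by auto
  show "embedding_map (top_of_set (closure M)) (horofunction_compactification M d) P"
    unfolding horofunction_compactification_def Let_def embedding_map_in_subtopology
    using emb sub by simp
qed

end

section \<open>Analytic discs and the Kobayashi distance\<close>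

lemma poincare_dist_Moebius: "poincare_dist z w = artanh (cmod (Moebius_function 0 w z))"
  by (simp add: poincare_dist_def Moebius_function_simple)

lemma poincare_dist_nonneg:
  assumes "z \<in> ball 0 1" "w \<in> ball 0 1"
  shows "0 \<le> poincare_dist z w"
proof -
  have "cmod (Moebius_function 0 w z) < 1" using assms by (intro Moebius_function_norm_lt_1) auto
  then show ?thesis unfolding poincare_dist_Moebius artanh_def by (simp add: ln_ge_zero_iff)
qed

lemma poincare_dist_zero_left: "poincare_dist 0 w = artanh (cmod w)"
  by (simp add: poincare_dist_def)

text \<open>
  Real points of the disc lie on a geodesic through 0: with \<open>y = (r - t) / (1 - r t)\<close> one has
  \<open>(1 + y) / (1 - y) = ((1 + r) (1 - t)) / ((1 - r) (1 + t))\<close>.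
\<close>

lemma poincare_dist_additive:
  fixes r t :: real
  assumes "0 \<le> t" "t \<le> r" "r < 1"
  shows "poincare_dist 0 (of_real t) + poincare_dist (of_real t) (of_real r) = artanh r"
proof -
  have rt: "0 < 1 - r * t" using mult_left_le [of t r] assms by simp
  let ?y = "(r - t) / (1 - r * t)"
  have "(of_real t - of_real r) / (1 - cnj (of_real r) * of_real t) = (of_real (- ?y) :: complex)"
    by (simp add: divide_simps)
  then have "cmod ((of_real t - of_real r) / (1 - cnj (of_real r) * of_real t)) = \<bar>- ?y\<bar>"
    by (simp only: norm_of_real)
  then have y: "poincare_dist (of_real t) (of_real r) = artanh ?y"
    unfolding poincare_dist_def using rt assms by simp
  have "(1 + ?y) / (1 - ?y) = ((1 - r * t) + (r - t)) / ((1 - r * t) - (r - t))"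
    using rt by (simp add: add_divide_eq_iff diff_divide_eq_iff)
  also have "\<dots> = ((1 + r) * (1 - t)) / ((1 - r) * (1 + t))" by (simp add: algebra_simps)
  finally have eq: "(1 + ?y) / (1 - ?y) = ((1 + r) * (1 - t)) / ((1 - r) * (1 + t))" .
  have "artanh ?y = ln (((1 + r) * (1 - t)) / ((1 - r) * (1 + t))) / 2" unfolding artanh_def eq ..
  then have "artanh t + artanh ?y = artanh r"
    using assms unfolding artanh_def by (simp add: ln_div ln_mult add_divide_distrib [symmetric])
  then show ?thesis unfolding y poincare_dist_zero_left using assms by simp
qed

lemma analytic_discD:
  assumes "analytic_disc \<Omega> f" "z \<in> ball 0 1"
  shows "f z \<in> \<Omega>"
  using assms unfolding analytic_disc_def by blast

lemma analytic_disc_compose: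
  assumes "analytic_disc \<Omega> f" "h holomorphic_on ball 0 1" "h ` ball 0 1 \<subseteq> ball 0 1"
  shows "analytic_disc \<Omega> (f \<circ> h)"
proof -
  have "(\<lambda>z. f z $ j) \<circ> h holomorphic_on ball 0 1" for j
    using holomorphic_on_compose_gen [OF assms(2) _ assms(3)] assms(1)
    unfolding analytic_disc_def by blast
  moreover have "(f \<circ> h) ` ball 0 1 \<subseteq> \<Omega>"
    using analytic_discD [OF assms(1)] assms(3) by (auto simp: image_subset_iff)
  ultimately show ?thesis unfolding analytic_disc_def by (simp add: o_def)
qed

lemma continuous_on_analytic_disc:
  assumes "analytic_disc \<Omega> f"
  shows "continuous_on (ball 0 1) f"
proof -
  have "continuous_on (ball 0 1) (\<lambda>z. \<chi> j. f z $ j)"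
    using assms unfolding analytic_disc_def
    by (intro continuous_on_vec_lambda holomorphic_on_imp_continuous_on) blast
  then show ?thesis by simp
qed

text \<open>
  Precompose with the automorphism of the disc that takes 0 to \<open>a\<close> and a point \<open>r \<ge> 0\<close> to
  \<open>b\<close>. If \<open>a = b\<close>, the rotation by \<open>sgn w = 0\<close> degenerates to a constant disc, which is good
  enough.
\<close>

lemma analytic_disc_normalise:
  assumes f: "analytic_disc \<Omega> f" and ab: "a \<in> ball 0 1" "b \<in> ball 0 1"
  obtains g r where "analytic_disc \<Omega> g" "0 \<le> r" "r < 1" "g 0 = f a" "g (of_real r) = f b"
    "poincare_dist a b = artanh r"
proof -
  let ?M = "Moebius_function 0"
  define w where "w = ?M a b"
  define h where "h z = ?M (- a) (z * sgn w)" for z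
  have w1: "cmod w < 1" unfolding w_def using ab by (intro Moebius_function_norm_lt_1) auto
  have rot: "z * sgn w \<in> ball 0 1" if "z \<in> ball 0 1" for z
    using that by (auto simp: norm_mult norm_sgn)
  have "(?M (- a) \<circ> (\<lambda>z. z * sgn w)) holomorphic_on ball 0 1"
  proof (rule holomorphic_on_compose_gen)
    show "(\<lambda>z. z * sgn w) holomorphic_on ball 0 1" by (intro holomorphic_intros)
    show "?M (- a) holomorphic_on ball 0 1" using ab by (intro Moebius_function_holomorphic) auto
    show "(\<lambda>z. z * sgn w) ` ball 0 1 \<subseteq> ball 0 1" using rot by blast
  qed
  then have hol: "h holomorphic_on ball 0 1" unfolding h_def o_def .
  have "h z \<in> ball 0 1" if "z \<in> ball 0 1" for z
    unfolding h_def using Moebius_function_norm_lt_1 [of "- a" "z * sgn w" 0] ab rot [OF that] by simp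
  then have img: "h ` ball 0 1 \<subseteq> ball 0 1" by blast
  have "f (h 0) = f a" by (simp add: h_def Moebius_function_of_zero)
  moreover have "of_real (cmod w) * sgn w = w"
    by (cases "w = 0") (simp_all add: sgn_div_norm scaleR_conv_of_real)
  then have "h (of_real (cmod w)) = b"
    using Moebius_function_compose [of "- a" a b] ab by (simp add: h_def w_def)
  moreover have "cmod w = cmod (?M b a)"
  proof -
    have "cmod (1 - cnj a * b) = cmod (1 - cnj b * a)"
      using complex_mod_cnj [of "1 - cnj a * b"] by (simp add: mult.commute)
    then show ?thesis
      by (simp add: w_def Moebius_function_simple norm_divide norm_minus_commute)
  qed
  ultimately show thesis
    using that [OF analytic_disc_compose [OF f hol img], of "cmod w"] w1
    by (simp add: poincare_dist_Moebius)
qed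

lemma norm_vector_mult:
  fixes v :: "complex ^ 'd"
  shows "norm (\<chi> j. c * v $ j) = cmod c * norm v"
  by (simp add: norm_vec_def norm_mult L2_set_right_distrib)

text \<open>
  A complex line through \<open>u\<close> and \<open>v\<close> meets the ball in a disc of radius \<open>R\<close>.
\<close>

lemma affine_disc:
  fixes u v :: "complex ^ 'd"
  assumes R: "ball u R \<subseteq> \<Omega>" and v: "dist u v < R"
  obtains f where "analytic_disc \<Omega> f" "f 0 = u" "f (of_real (dist u v / R)) = v"
    "of_real (dist u v / R) \<in> ball (0::complex) 1"
proof -
  have R0: "0 < R" using v zero_le_dist [of u v] by linarith
  define e where "e = (1 / norm (v - u)) *\<^sub>R (v - u)"
  define f where "f z = u + (\<chi> j. (z * of_real R) * e $ j)" for z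
  have e: "norm e \<le> 1" by (simp add: e_def)
  have "f z \<in> \<Omega>" if "z \<in> ball 0 1" for z
  proof -
    have "norm (f z - u) \<le> cmod z * R"
      using e R0 mult_left_le [of "norm e" "cmod z * R"] unfolding f_def
      by (simp add: norm_vector_mult norm_mult)
    also have "\<dots> < R" using that R0 by simp
    finally show ?thesis using R by (auto simp: dist_norm norm_minus_commute)
  qed
  moreover have "(\<lambda>z. f z $ j) holomorphic_on ball 0 1" for j
    unfolding f_def by (simp, intro holomorphic_intros)
  ultimately have "analytic_disc \<Omega> f" unfolding analytic_disc_def by blast
  moreover have "f 0 = u" by (simp add: f_def vec_eq_iff)
  moreover have "f (of_real (dist u v / R)) = v"
  proof (cases "u = v")
    case True
    then show ?thesis by (simp add: f_def vec_eq_iff)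
  next
    case False
    have "of_real (dist u v / R) * of_real R * e $ j = v $ j - u $ j" for j
    proof -
      have "e $ j = (v $ j - u $ j) / of_real (dist u v)"
        unfolding e_def vector_scaleR_component
        by (simp add: scaleR_conv_of_real dist_norm norm_minus_commute)
      then show ?thesis using False R0 by simp
    qed
    then show ?thesis by (simp add: f_def vec_eq_iff)
  qed
  moreover have "of_real (dist u v / R) \<in> ball (0::complex) 1"
    unfolding mem_ball_0 norm_of_real using R0 v by simp
  ultimately show thesis by (rule that)
qed

definition chain_lengths :: "(complex ^ 'd) set \<Rightarrow> complex ^ 'd \<Rightarrow> complex ^ 'd \<Rightarrow> real set" where
  "chain_lengths \<Omega> x y =
     {\<Sum>i<n. poincare_dist (a i) (b i) | n f a b. kobayashi_chain \<Omega> x y n f a b}"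

lemma kobayashi_eq_Inf: "\<lbrakk>x \<in> \<Omega>; y \<in> \<Omega>\<rbrakk> \<Longrightarrow> kobayashi \<Omega> x y = Inf (chain_lengths \<Omega> x y)"
  by (simp add: kobayashi_def chain_lengths_def)

lemma chain_lengths_nonneg:
  assumes "s \<in> chain_lengths \<Omega> x y"
  shows "0 \<le> s"
proof -
  obtain n f a b where s: "s = (\<Sum>i<n. poincare_dist (a i) (b i))" and c: "kobayashi_chain \<Omega> x y n f a b"
    using assms unfolding chain_lengths_def by blast
  show ?thesis unfolding s
  proof (rule sum_nonneg)
    fix i assume "i \<in> {..<n}"
    then show "0 \<le> poincare_dist (a i) (b i)"
      using c unfolding kobayashi_chain_def by (intro poincare_dist_nonneg) auto
  qed
qed

lemma chain_lengths_refl: "0 \<in> chain_lengths \<Omega> x x"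
proof -
  have "kobayashi_chain \<Omega> x x 0 f a b" for f a b
    by (auto simp: kobayashi_chain_def)
  then show ?thesis unfolding chain_lengths_def by force
qed

lemma chain_lengths_extend:
  assumes s: "s \<in> chain_lengths \<Omega> x y"
    and g: "analytic_disc \<Omega> g" "\<alpha> \<in> ball 0 1" "\<beta> \<in> ball 0 1" "g \<alpha> = y" "g \<beta> = z"
  shows "s + poincare_dist \<alpha> \<beta> \<in> chain_lengths \<Omega> x z"
proof -
  obtain n f a b where s: "s = (\<Sum>i<n. poincare_dist (a i) (b i))" and c: "kobayashi_chain \<Omega> x y n f a b"
    using s unfolding chain_lengths_def by blast
  obtain p where p: "p 0 = x" "p n = y" "\<And>i. i < n \<Longrightarrow> f i (a i) = p i \<and> f i (b i) = p (Suc i)"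
    using c unfolding kobayashi_chain_def by blast
  have "kobayashi_chain \<Omega> x z (Suc n) (f(n := g)) (a(n := \<alpha>)) (b(n := \<beta>))"
    unfolding kobayashi_chain_def
  proof (intro conjI exI [of _ "p(Suc n := z)"])
    show "\<forall>i<Suc n. analytic_disc \<Omega> ((f(n := g)) i) \<and> (a(n := \<alpha>)) i \<in> ball 0 1 \<and> (b(n := \<beta>)) i \<in> ball 0 1"
      using c g unfolding kobayashi_chain_def by (auto simp: less_Suc_eq)
    show "\<forall>i<Suc n. (f(n := g)) i ((a(n := \<alpha>)) i) = (p(Suc n := z)) i \<and>
        (f(n := g)) i ((b(n := \<beta>)) i) = (p(Suc n := z)) (Suc i)"
      using p g by (auto simp: less_Suc_eq)
  qed (use p in auto)
  moreover have "s + poincare_dist \<alpha> \<beta> =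
      (\<Sum>i<Suc n. poincare_dist ((a(n := \<alpha>)) i) ((b(n := \<beta>)) i))"
    unfolding s by simp
  ultimately show ?thesis unfolding chain_lengths_def by blast
qed

text \<open>
  Induction on the number of discs, with the sequences of discs and points hidden.
\<close>

lemma chain_lengths_induct [consumes 2, case_names refl extend]:
  assumes s: "s \<in> chain_lengths \<Omega> x y" and x: "x \<in> \<Omega>"
    and refl: "P x 0"
    and extend: "\<And>y s g \<alpha> \<beta>. \<lbrakk>P y s; y \<in> \<Omega>; analytic_disc \<Omega> g; \<alpha> \<in> ball 0 1; \<beta> \<in> ball 0 1; g \<alpha> = y\<rbrakk> \<Longrightarrow>
      P (g \<beta>) (s + poincare_dist \<alpha> \<beta>)"
  shows "P y s"
proof -
  obtain n f a b where s: "s = (\<Sum>i<n. poincare_dist (a i) (b i))" and c: "kobayashi_chain \<Omega> x y n f a b"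
    using s unfolding chain_lengths_def by blast
  from c show ?thesis unfolding s
  proof (induction n arbitrary: y)
    case 0
    then have "x = y" by (auto simp: kobayashi_chain_def)
    then show ?case using refl by simp
  next
    case (Suc n)
    obtain p where p: "p 0 = x" "p (Suc n) = y" "\<And>i. i < Suc n \<Longrightarrow> f i (a i) = p i \<and> f i (b i) = p (Suc i)"
      using Suc.prems unfolding kobayashi_chain_def by blast
    have disc: "analytic_disc \<Omega> (f n)" "a n \<in> ball 0 1" "b n \<in> ball 0 1"
      using Suc.prems unfolding kobayashi_chain_def by auto
    have "kobayashi_chain \<Omega> x (p n) n f a b"
      using Suc.prems p unfolding kobayashi_chain_def by (auto intro!: exI [of _ p])
    then have IH: "P (p n) (\<Sum>i<n. poincare_dist (a i) (b i))" by (rule Suc.IH)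
    have fa: "f n (a n) = p n" and fb: "f n (b n) = y" using p(2) p(3) [of n] by auto
    have "p n \<in> \<Omega>" using analytic_discD [OF disc(1,2)] fa by simp
    from extend [OF IH this disc fa] show ?case by (simp add: fb)
  qed
qed

lemma kobayashi_le_poincare_dist:
  assumes g: "analytic_disc \<Omega> g" "\<alpha> \<in> ball 0 1" "\<beta> \<in> ball 0 1"
  shows "kobayashi \<Omega> (g \<alpha>) (g \<beta>) \<le> poincare_dist \<alpha> \<beta>"
proof -
  have "0 + poincare_dist \<alpha> \<beta> \<in> chain_lengths \<Omega> (g \<alpha>) (g \<beta>)"
    by (rule chain_lengths_extend [OF chain_lengths_refl g refl refl])
  moreover have "bdd_below (chain_lengths \<Omega> (g \<alpha>) (g \<beta>))"
    using chain_lengths_nonneg by (intro bdd_belowI [of _ 0])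
  ultimately show ?thesis
    using analytic_discD [OF g(1)] g(2,3) by (simp add: kobayashi_eq_Inf cInf_lower)
qed

lemma kobayashi_le_artanh:
  assumes R: "ball u R \<subseteq> \<Omega>" and v: "dist u v < R"
  shows "kobayashi \<Omega> u v \<le> artanh (dist u v / R)"
proof -
  obtain f where f: "analytic_disc \<Omega> f" "f 0 = u" "f (of_real (dist u v / R)) = v"
    "of_real (dist u v / R) \<in> ball (0::complex) 1"
    using affine_disc [OF R v] by blast
  have R0: "0 < R" using v zero_le_dist [of u v] by linarith
  from kobayashi_le_poincare_dist [OF f(1) _ f(4), of 0] show ?thesis
    using f R0 by (simp add: poincare_dist_zero_left norm_divide)
qed

text \<open>
  Inside a ball any two points lie on one disc, so the set of points joined to \<open>x\<close> by a chain
  is open and closed in the domain.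
\<close>

lemma chain_lengths_nonempty:
  assumes op: "open \<Omega>" and con: "connected \<Omega>" and xy: "x \<in> \<Omega>" "y \<in> \<Omega>"
  shows "chain_lengths \<Omega> x y \<noteq> {}"
proof (rule connected_induction_simple [where P = "\<lambda>v. chain_lengths \<Omega> x v \<noteq> {}", OF con xy])
  show "chain_lengths \<Omega> x x \<noteq> {}" using chain_lengths_refl by blast
  fix z assume "z \<in> \<Omega>"
  then obtain r where r: "0 < r" "ball z r \<subseteq> \<Omega>" using op openE by blast
  have step: "chain_lengths \<Omega> x v \<noteq> {}"
    if uv: "u \<in> ball z (r/3)" "v \<in> ball z (r/3)" and ne: "chain_lengths \<Omega> x u \<noteq> {}" for u v
  proof -
    have d: "dist u v < 2 * r / 3" using uv dist_triangle [of u v z] by (simp add: dist_commute)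
    have "ball u (2 * r / 3) \<subseteq> ball z r"
    proof
      fix w assume "w \<in> ball u (2 * r / 3)"
      then show "w \<in> ball z r" using uv(1) dist_triangle [of z w u] by simp
    qed
    then have "ball u (2 * r / 3) \<subseteq> \<Omega>" using r(2) by blast
    then obtain f where f: "analytic_disc \<Omega> f" "f 0 = u" "f (of_real (dist u v / (2 * r / 3))) = v"
      "of_real (dist u v / (2 * r / 3)) \<in> ball (0::complex) 1"
      using affine_disc [OF _ d] by blast
    obtain s where "s \<in> chain_lengths \<Omega> x u" using ne by blast
    from chain_lengths_extend [OF this f(1) _ f(4) f(2,3)] show ?thesis by auto
  qed
  have "ball z (r/3) \<subseteq> \<Omega>" using subset_ball [of "r/3" r z] r by auto
  then have op3: "openin (top_of_set \<Omega>) (ball z (r/3))" by (rule open_openin_trans [OF op open_ball])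
  have "z \<in> ball z (r/3)" using r(1) by simp
  with op3 show "\<exists>T. openin (top_of_set \<Omega>) T \<and> z \<in> T \<and>
      (\<forall>u\<in>T. \<forall>v\<in>T. chain_lengths \<Omega> x u \<noteq> {} \<longrightarrow> chain_lengths \<Omega> x v \<noteq> {})"
  proof (intro exI [of _ "ball z (r/3)"] conjI ballI impI)
    show "chain_lengths \<Omega> x v \<noteq> {}"
      if "u \<in> ball z (r/3)" "v \<in> ball z (r/3)" "chain_lengths \<Omega> x u \<noteq> {}" for u v
      by (rule step [OF that])
  qed
qed

section \<open>The Kobayashi metric space\<close>

lemma connected_attains_distance:
  fixes C :: "'a::metric_space set"
  assumes C: "connected C" "x \<in> C" "y \<in> C" and s: "0 \<le> s" "s \<le> dist y x"
  shows "\<exists>z\<in>C. dist z x = s"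
proof -
  have "connected ((\<lambda>z. dist z x) ` C)"
    by (intro connected_continuous_image C continuous_intros)
  then have "s \<in> (\<lambda>z. dist z x) ` C"
    by (rule connectedD_interval [of _ "dist x x" "dist y x"]) (use C s in auto)
  then show ?thesis by auto
qed

locale kobayashi_domain = Metric_space \<Omega> "kobayashi \<Omega>" for \<Omega> :: "(complex ^ 'd) set" +
  assumes open_domain: "open \<Omega>" and connected_domain: "connected \<Omega>"
begin

abbreviation k where "k \<equiv> kobayashi \<Omega>"

text \<open>
  The image of the hyperbolic segment from \<open>a\<close> to \<open>b\<close>.
\<close>

lemma disc_connecting_set:
  assumes f: "analytic_disc \<Omega> f" "a \<in> ball 0 1" "b \<in> ball 0 1"
  obtains C where "connected C" "C \<subseteq> \<Omega>" "f a \<in> C" "f b \<in> C"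
    "\<And>z. z \<in> C \<Longrightarrow> k (f a) z + k z (f b) \<le> poincare_dist a b"
proof -
  obtain g r where g: "analytic_disc \<Omega> g" "0 \<le> r" "r < 1" "g 0 = f a" "g (of_real r) = f b"
    "poincare_dist a b = artanh r"
    using analytic_disc_normalise [OF f] by blast
  let ?I = "complex_of_real ` {0..r}"
  have I: "?I \<subseteq> ball 0 1" using g(3) by auto
  have "connected ?I" by (intro connected_continuous_image continuous_intros) simp
  then have conn: "connected (g ` ?I)"
    by (rule connected_continuous_image [OF continuous_on_subset [OF continuous_on_analytic_disc [OF g(1)] I]])
  have ends: "g 0 \<in> g ` ?I" "g (of_real r) \<in> g ` ?I" using g(2) by force+
  have bound: "k (f a) z + k z (f b) \<le> poincare_dist a b" if z: "z \<in> g ` ?I" for z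
  proof -
    obtain t where t: "0 \<le> t" "t \<le> r" "z = g (of_real t)" using z by auto
    have b: "(0::complex) \<in> ball 0 1" "complex_of_real t \<in> ball 0 1" "complex_of_real r \<in> ball 0 1"
      using t g(2,3) by auto
    show ?thesis
      using kobayashi_le_poincare_dist [OF g(1) b(1,2)] kobayashi_le_poincare_dist [OF g(1) b(2,3)]
        poincare_dist_additive [OF t(1,2) g(3)] g(4-6) t(3) by simp
  qed
  have "g ` ?I \<subseteq> \<Omega>" using analytic_discD [OF g(1)] I by blast
  from that [OF conn this _ _ bound] show thesis using ends g(4,5) by simp
qed

text \<open>
  The segments of consecutive discs share an endpoint, so their union is connected, and the
  bounds for the single discs add up by the triangle inequality.
\<close>

lemma chain_connecting_set:
  assumes s: "s \<in> chain_lengths \<Omega> x y" and x: "x \<in> \<Omega>"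
  shows "\<exists>C. connected C \<and> C \<subseteq> \<Omega> \<and> x \<in> C \<and> y \<in> C \<and> (\<forall>z\<in>C. k x z + k z y \<le> s)"
  using s x
proof (induction rule: chain_lengths_induct)
  case refl
  then show ?case using x by (intro exI [of _ "{x}"]) simp
next
  case (extend y s g \<alpha> \<beta>)
  obtain C where C: "connected C" "C \<subseteq> \<Omega>" "x \<in> C" "y \<in> C" "\<forall>z\<in>C. k x z + k z y \<le> s"
    using extend.IH by blast
  obtain D where D: "connected D" "D \<subseteq> \<Omega>" "g \<alpha> \<in> D" "g \<beta> \<in> D"
    "\<And>z. z \<in> D \<Longrightarrow> k (g \<alpha>) z + k z (g \<beta>) \<le> poincare_dist \<alpha> \<beta>"
    using disc_connecting_set [OF extend.hyps(2-4)] by blast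
  have y: "g \<alpha> = y" by fact
  have M: "y \<in> \<Omega>" "g \<beta> \<in> \<Omega>" using C(2,4) D(2,4) by auto
  have "k x z + k z (g \<beta>) \<le> s + poincare_dist \<alpha> \<beta>" if z: "z \<in> C" for z
  proof -
    have "z \<in> \<Omega>" using z C(2) by blast
    from triangle [OF this M] show ?thesis
      using C(5) z D(5) [OF D(4)] y M by fastforce
  qed
  moreover have "k x z + k z (g \<beta>) \<le> s + poincare_dist \<alpha> \<beta>" if z: "z \<in> D" for z
  proof -
    have "z \<in> \<Omega>" using z D(2) by blast
    from triangle [OF x M(1) this] show ?thesis
      using bspec [OF C(5,4)] D(5) [OF z] y M(1) by simp
  qed
  moreover have "connected (C \<union> D)" using C D y by (intro connected_Un) auto
  ultimately show ?case using C D by (intro exI [of _ "C \<union> D"]) auto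
qed

lemma almost_geodesic_set:
  assumes xy: "x \<in> \<Omega>" "y \<in> \<Omega>" and e: "0 < e"
  obtains C where "connected C" "C \<subseteq> \<Omega>" "x \<in> C" "y \<in> C" "\<And>z. z \<in> C \<Longrightarrow> k x z + k z y \<le> k x y + e"
proof -
  have "Inf (chain_lengths \<Omega> x y) < k x y + e" using kobayashi_eq_Inf [OF xy] e by simp
  then obtain s where s: "s \<in> chain_lengths \<Omega> x y" "s < k x y + e"
    using cInf_lessD chain_lengths_nonempty [OF open_domain connected_domain xy] by blast
  obtain C where C: "connected C" "C \<subseteq> \<Omega>" "x \<in> C" "y \<in> C" "\<forall>z\<in>C. k x z + k z y \<le> s"
    using chain_connecting_set [OF s(1) xy(1)] by blast
  have "k x z + k z y \<le> k x y + e" if "z \<in> C" for z using bspec [OF C(5) that] s(2) by linarith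
  with C(1-4) show thesis by (rule that)
qed

lemma kobayashi_small:
  assumes u: "u \<in> \<Omega>" and e: "0 < e"
  shows "\<exists>\<delta>>0. \<forall>v. dist u v < \<delta> \<longrightarrow> v \<in> \<Omega> \<and> k u v < e"
proof -
  obtain R where R: "0 < R" "ball u R \<subseteq> \<Omega>" using open_domain u openE by blast
  have "(artanh \<longlongrightarrow> artanh 0) (at (0::real))"
    by (intro tendsto_artanh tendsto_ident_at) auto
  then obtain \<eta> where \<eta>: "0 < \<eta>" "\<And>s. \<lbrakk>s \<noteq> 0; \<bar>s\<bar> < \<eta>\<rbrakk> \<Longrightarrow> \<bar>artanh s\<bar> < e"
    using tendstoD [OF _ e, of artanh "artanh (0::real)" "at 0"] unfolding eventually_at
    by (auto simp: dist_real_def)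
  have "v \<in> \<Omega> \<and> k u v < e" if v: "dist u v < min R (\<eta> * R)" for v
  proof
    show "v \<in> \<Omega>" using v R(2) by auto
    have "k u v \<le> artanh (dist u v / R)" using kobayashi_le_artanh [OF R(2)] v by simp
    also have "\<dots> < e"
    proof (cases "dist u v / R = 0")
      case True
      then show ?thesis using e by (metis artanh_0)
    next
      case False
      have "\<bar>dist u v / R\<bar> < \<eta>" using v R(1) by (simp add: divide_less_eq)
      from \<eta>(2) [OF False this] show ?thesis by simp
    qed
    finally show "k u v < e" .
  qed
  moreover have "0 < min R (\<eta> * R)" using R(1) \<eta>(1) by simp
  ultimately show ?thesis by blast
qed

lemma continuous_on_kobayashi:
  assumes x: "x \<in> \<Omega>"
  shows "continuous_on \<Omega> (k x)"
  unfolding continuous_on_iff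
proof (intro ballI allI impI)
  fix u and e :: real assume u: "u \<in> \<Omega>" and e: "0 < e"
  obtain \<delta> where \<delta>: "0 < \<delta>" "\<forall>v. dist u v < \<delta> \<longrightarrow> v \<in> \<Omega> \<and> k u v < e"
    using kobayashi_small [OF u e] by blast
  have "dist (k x v) (k x u) < e" if v: "v \<in> \<Omega>" "dist v u < \<delta>" for v
  proof -
    have "k u v < e" using \<delta>(2) v by (simp add: dist_commute)
    then show ?thesis
      using triangle [OF x u v(1)] triangle [OF x v(1) u] commute [of u v] by (simp add: dist_real_def)
  qed
  with \<delta>(1) show "\<exists>\<delta>>0. \<forall>v\<in>\<Omega>. dist v u < \<delta> \<longrightarrow> dist (k x v) (k x u) < e" by blast
qed

text \<open>
  The intermediate value theorem for \<open>d(x, \<cdot>)\<close> on an almost geodesic connected set.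
\<close>

lemma kobayashi_length_space: length_space
  unfolding length_space_def
proof (intro ballI allI impI)
  fix x y s e assume xy: "x \<in> \<Omega>" "y \<in> \<Omega>" and s: "0 \<le> s \<and> s \<le> k x y \<and> (0::real) < e"
  then have e: "0 < e" by blast
  obtain C where C: "connected C" "C \<subseteq> \<Omega>" "x \<in> C" "y \<in> C" "\<And>z. z \<in> C \<Longrightarrow> k x z + k z y \<le> k x y + e"
    using almost_geodesic_set [OF xy e] by blast
  have "connected (k x ` C)"
    by (rule connected_continuous_image [OF continuous_on_subset [OF continuous_on_kobayashi [OF xy(1)] C(2)] C(1)])
  then have "s \<in> k x ` C"
    by (rule connectedD_interval [OF _ imageI [OF C(3)] imageI [OF C(4)]]) (use s xy in auto)
  then obtain z where z: "z \<in> C" "s = k x z" by blast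
  have "k z y \<le> k x y - s + e" using C(5) [OF z(1)] z(2) by simp
  then show "\<exists>z\<in>\<Omega>. k x z = s \<and> k z y \<le> k x y - s + e"
    using z C(2) by (intro bexI [of _ z]) auto
qed

text \<open>
  Barth's argument: let \<open>m\<close> be the minimum of \<open>d(x, \<cdot>)\<close> on a small Euclidean sphere about
  \<open>x\<close>. A point at distance less than \<open>m\<close> from \<open>x\<close> cannot lie outside this sphere, since an
  almost geodesic connected set would cross it.
\<close>

lemma euclidean_small:
  assumes x: "x \<in> \<Omega>" and r: "0 < r"
  shows "\<exists>m>0. \<forall>y\<in>\<Omega>. k x y < m \<longrightarrow> dist y x < r"
proof -
  obtain R where R: "0 < R" "ball x R \<subseteq> \<Omega>" using open_domain x openE by blast
  define \<rho> where "\<rho> = min r (R/2)"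
  have \<rho>: "0 < \<rho>" "\<rho> \<le> r" "\<rho> < R" using r R(1) by (auto simp: \<rho>_def)
  have S: "sphere x \<rho> \<subseteq> \<Omega>" using R(2) \<rho>(3) by auto
  have "\<exists>m>0. \<forall>z\<in>sphere x \<rho>. m \<le> k x z"
  proof (cases "sphere x \<rho> = {}")
    case True
    then show ?thesis by (intro exI [of _ 1]) simp
  next
    case False
    obtain w where w: "w \<in> sphere x \<rho>" "\<forall>z\<in>sphere x \<rho>. k x w \<le> k x z"
      using continuous_attains_inf [OF compact_sphere False
          continuous_on_subset [OF continuous_on_kobayashi [OF x] S]] by blast
    have "w \<noteq> x" "w \<in> \<Omega>" using w(1) \<rho>(1) S by auto
    then have "0 < k x w" using x by (metis mdist_pos_less)
    with w(2) show ?thesis by blast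
  qed
  then obtain m where m: "0 < m" "\<forall>z\<in>sphere x \<rho>. m \<le> k x z" by blast
  have "dist y x < r" if y: "y \<in> \<Omega>" "k x y < m" for y
  proof (rule ccontr)
    assume "\<not> dist y x < r"
    then have far: "\<rho> \<le> dist y x" using \<rho>(2) by simp
    define e where "e = (m - k x y) / 2"
    have e: "0 < e" "k x y + e < m" using y(2) by (auto simp: e_def field_simps)
    obtain C where C: "connected C" "C \<subseteq> \<Omega>" "x \<in> C" "y \<in> C" "\<And>z. z \<in> C \<Longrightarrow> k x z + k z y \<le> k x y + e"
      using almost_geodesic_set [OF x y(1) e(1)] by blast
    obtain z where z: "z \<in> C" "dist z x = \<rho>"
      using connected_attains_distance [OF C(1,3,4) _ far] \<rho>(1) by auto
    have "m \<le> k x z" using m(2) z(2) by (simp add: dist_commute)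
    then show False using C(5) [OF z(1)] e(2) nonneg [of z y] by linarith
  qed
  with m(1) show ?thesis by blast
qed

theorem kobayashi_topology: "mtopology = top_of_set \<Omega>"
proof (rule topology_eq [THEN iffD2], intro allI iffI)
  fix U assume U: "openin mtopology U"
  show "openin (top_of_set \<Omega>) U"
    unfolding openin_euclidean_subtopology_iff
  proof (intro conjI ballI)
    show "U \<subseteq> \<Omega>" using openin_subset [OF U] by simp
    fix x assume x: "x \<in> U"
    then have x\<Omega>: "x \<in> \<Omega>" using openin_subset [OF U] by auto
    obtain r where r: "0 < r" "mball x r \<subseteq> U" using U x unfolding openin_mtopology by blast
    obtain \<delta> where \<delta>: "0 < \<delta>" "\<forall>v. dist x v < \<delta> \<longrightarrow> v \<in> \<Omega> \<and> k x v < r"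
      using kobayashi_small [OF x\<Omega> r(1)] by blast
    have "v \<in> U" if "v \<in> \<Omega>" "dist v x < \<delta>" for v
    proof -
      have "v \<in> mball x r" using \<delta>(2) that x\<Omega> by (simp add: dist_commute)
      then show ?thesis using r(2) by blast
    qed
    with \<delta>(1) show "\<exists>e>0. \<forall>v\<in>\<Omega>. dist v x < e \<longrightarrow> v \<in> U" by blast
  qed
next
  fix U assume U: "openin (top_of_set \<Omega>) U"
  show "openin mtopology U" unfolding openin_mtopology
  proof (intro conjI allI impI)
    show "U \<subseteq> \<Omega>" using openin_subset [OF U] by simp
    fix x assume x: "x \<in> U"
    then have x\<Omega>: "x \<in> \<Omega>" using openin_subset [OF U] by auto
    obtain r where r: "0 < r" "\<forall>y\<in>\<Omega>. dist y x < r \<longrightarrow> y \<in> U"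
      using U x unfolding openin_euclidean_subtopology_iff by blast
    obtain m where m: "0 < m" "\<forall>y\<in>\<Omega>. k x y < m \<longrightarrow> dist y x < r"
      using euclidean_small [OF x\<Omega> r(1)] by blast
    have "mball x m \<subseteq> U" using r(2) m(2) by auto
    with m(1) show "\<exists>r>0. mball x r \<subseteq> U" by blast
  qed
qed

lemma kobayashi_proper:
  assumes mcomplete
  shows "compactin mtopology (mcball x r)"
proof (rule Hopf_Rinow [OF assms _ kobayashi_length_space])
  fix x assume x: "x \<in> \<Omega>"
  obtain R where R: "0 < R" "cball x R \<subseteq> \<Omega>" using open_domain x open_contains_cball by blast
  obtain m where m: "0 < m" "\<forall>y\<in>\<Omega>. k x y < m \<longrightarrow> dist y x < R"
    using euclidean_small [OF x R(1)] by blast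
  have "mcball x (m/2) \<subseteq> cball x R"
  proof
    fix y assume "y \<in> mcball x (m/2)"
    then have "y \<in> \<Omega>" "k x y < m" using m(1) by auto
    then have "dist y x < R" using m(2) by blast
    then show "y \<in> cball x R" by (simp add: dist_commute)
  qed
  moreover have "compactin mtopology (cball x R)"
    unfolding kobayashi_topology using R(2) by (simp add: compactin_subtopology)
  ultimately have "compactin mtopology (mcball x (m/2))"
    using closed_compactin closedin_mcball by blast
  with m(1) show "\<exists>r>0. compactin mtopology (mcball x r)" by (intro exI [of _ "m/2"]) simp
qed

lemma continuous_on_geodesic_segment:
  assumes \<gamma>: "geodesic_segment \<Omega> k a b \<gamma>"
  shows "continuous_on {a..b} \<gamma>"
  unfolding continuous_on_iff
proof (intro ballI allI impI)
  fix s and e :: real assume s: "s \<in> {a..b}" and e: "0 < e"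
  have M: "\<gamma> t \<in> \<Omega>" "k (\<gamma> s) (\<gamma> t) = \<bar>s - t\<bar>" if "t \<in> {a..b}" for t
    using \<gamma> s that unfolding geodesic_segment_def by auto
  obtain m where m: "0 < m" "\<forall>y\<in>\<Omega>. k (\<gamma> s) y < m \<longrightarrow> dist y (\<gamma> s) < e"
    using euclidean_small [OF M(1) [OF s] e] by blast
  have "dist (\<gamma> t) (\<gamma> s) < e" if "t \<in> {a..b}" "dist t s < m" for t
    using m(2) M [OF that(1)] that(2) by (simp add: dist_real_def abs_minus_commute)
  with m(1) show "\<exists>\<delta>>0. \<forall>t\<in>{a..b}. dist t s < \<delta> \<longrightarrow> dist (\<gamma> t) (\<gamma> s) < e" by blast
qed

text \<open>
  Otherwise there are points \<open>Y n\<close> tending to \<open>\<xi>\<close> and points \<open>Z n\<close> at Euclidean distance at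
  least \<open>r\<close> from \<open>\<xi>\<close> such that a geodesic from \<open>Y n\<close> to \<open>Z n\<close> avoids the ball of radius \<open>n\<close>
  about \<open>p\<close>. These geodesics cross the compact sphere of radius \<open>r/2\<close> about \<open>\<xi>\<close>, and a limit
  \<open>q\<close> of the crossing points is a boundary point because their Kobayashi distance from \<open>p\<close>
  tends to infinity. The initial pieces of the geodesics contradict visibility for the pair
  \<open>\<xi>\<close>, \<open>q\<close>. Using \<open>q\<close> instead of the points \<open>Z n\<close> makes the argument work for unbounded
  domains, where \<open>Z n\<close> may have no limit.
\<close>

theorem visibility_separation:
  assumes vis: "geodesic_visibility \<Omega>" and complete: mcomplete
    and \<xi>: "\<xi> \<in> closure \<Omega> - \<Omega>" and r: "0 < r" and p: "p \<in> \<Omega>"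
  shows "\<exists>\<delta>>0. \<exists>R. \<forall>y\<in>\<Omega>. \<forall>z\<in>\<Omega>. dist y \<xi> < \<delta> \<longrightarrow> r \<le> dist z \<xi> \<longrightarrow> k p y + k p z - 2 * R \<le> k y z"
proof (rule ccontr)
  assume not: "\<not> ?thesis"
  have "\<exists>y z. y \<in> \<Omega> \<and> z \<in> \<Omega> \<and> dist y \<xi> < min (r/2) (inverse (Suc n)) \<and> r \<le> dist z \<xi> \<and>
      k y z < k p y + k p z - 2 * real n" for n
  proof -
    have "0 < min (r/2) (inverse (Suc n))" using r by simp
    with not show ?thesis by (meson not_le)
  qed
  then obtain Y Z where YZ: "\<And>n. Y n \<in> \<Omega>" "\<And>n. Z n \<in> \<Omega>"
    and Y: "\<And>n. dist (Y n) \<xi> < min (r/2) (inverse (Suc n))" and Z: "\<And>n. r \<le> dist (Z n) \<xi>"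
    and short: "\<And>n. k (Y n) (Z n) < k p (Y n) + k p (Z n) - 2 * real n"
    by metis
  have "\<forall>n. \<exists>\<gamma>. geodesic_segment \<Omega> k 0 (k (Y n) (Z n)) \<gamma> \<and> \<gamma> 0 = Y n \<and> \<gamma> (k (Y n) (Z n)) = Z n"
    using proper_length_space_geodesic [OF kobayashi_proper [OF complete] kobayashi_length_space YZ]
    by blast
  then obtain G where G: "\<And>n. geodesic_segment \<Omega> k 0 (k (Y n) (Z n)) (G n)"
      "\<And>n. G n 0 = Y n" "\<And>n. G n (k (Y n) (Z n)) = Z n"
    by metis
  have Gk: "G n t \<in> \<Omega>" "k (G n t) (G n u) = \<bar>t - u\<bar>"
    if "t \<in> {0..k (Y n) (Z n)}" "u \<in> {0..k (Y n) (Z n)}" for n t u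
    using G(1) [of n] that unfolding geodesic_segment_def by auto
  \<comment> \<open>A point of the geodesic within \<open>n\<close> of \<open>p\<close> would make the distance of its endpoints too large.\<close>
  have escape: "real n < k p (G n t)" if t: "t \<in> {0..k (Y n) (Z n)}" for n t
  proof -
    have I: "0 \<in> {0..k (Y n) (Z n)}" "k (Y n) (Z n) \<in> {0..k (Y n) (Z n)}" by auto
    have "k (G n t) (Y n) = t" "k (G n t) (Z n) = k (Y n) (Z n) - t"
      using Gk(2) [OF t I(1)] Gk(2) [OF t I(2)] G(2,3) [of n] t by auto
    then show ?thesis
      using triangle [OF p Gk(1) [OF t t] YZ(1) [of n]] triangle [OF p Gk(1) [OF t t] YZ(2) [of n]]
        short [of n] by linarith
  qed
  have "\<exists>c\<in>{0..k (Y n) (Z n)}. dist (G n c) \<xi> = r/2" for n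
  proof -
    have cont: "continuous_on {0..k (Y n) (Z n)} (\<lambda>t. dist (G n t) \<xi>)"
      by (intro continuous_on_dist continuous_on_geodesic_segment [OF G(1)] continuous_on_const)
    have "dist (G n 0) \<xi> \<le> r/2" "r/2 \<le> dist (G n (k (Y n) (Z n))) \<xi>"
      using Y [of n] Z [of n] r G(2,3) [of n] by auto
    from IVT' [OF this _ cont] show ?thesis by auto
  qed
  then obtain c where c: "\<And>n. c n \<in> {0..k (Y n) (Z n)}" "\<And>n. dist (G n (c n)) \<xi> = r/2"
    by metis
  define W where "W n = G n (c n)" for n
  have W\<Omega>: "W n \<in> \<Omega>" for n unfolding W_def using Gk(1) [OF c(1) c(1)] .
  have "W n \<in> sphere \<xi> (r/2)" for n unfolding W_def using c(2) by (simp add: dist_commute)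
  then obtain q \<rho> where q: "q \<in> sphere \<xi> (r/2)" and \<rho>: "strict_mono \<rho>" "(W \<circ> \<rho>) \<longlonglongrightarrow> q"
    using compact_sphere [of \<xi> "r/2", THEN compact_imp_seq_compact] unfolding seq_compact_def by metis
  have "q \<in> closure \<Omega>"
    using W\<Omega> \<rho>(2) unfolding closure_sequential by (intro exI [of _ "W \<circ> \<rho>"]) simp
  have "q \<notin> \<Omega>"
  proof
    assume q\<Omega>: "q \<in> \<Omega>"
    have "((\<lambda>n. k p ((W \<circ> \<rho>) n)) \<longlonglongrightarrow> k p q)"
      by (rule continuous_on_tendsto_compose [OF continuous_on_kobayashi [OF p] \<rho>(2) q\<Omega>]) (use W\<Omega> in simp)
    then have "eventually (\<lambda>n. k p (W (\<rho> n)) < k p q + 1) sequentially"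
      using order_tendstoD(2) [of _ "k p q" sequentially "k p q + 1"] by simp
    moreover have "eventually (\<lambda>n. nat \<lceil>k p q + 1\<rceil> \<le> n) sequentially" by (rule eventually_ge_at_top)
    ultimately have "eventually (\<lambda>n. False) sequentially"
    proof eventually_elim
      case (elim n)
      have "real n < k p (W (\<rho> n))"
        using escape [OF c(1) [of "\<rho> n"]] seq_suble [OF \<rho>(1), of n] unfolding W_def by linarith
      moreover have "k p q + 1 \<le> real n" using elim(2) by linarith
      ultimately show ?case using elim(1) by linarith
    qed
    then show False by simp
  qed
  have frontier: "frontier \<Omega> = closure \<Omega> - \<Omega>" using open_domain by (simp add: frontier_def interior_open)
  have "\<xi> \<noteq> q" using q r by auto
  have "\<xi> \<in> frontier \<Omega>" "q \<in> frontier \<Omega>"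
    using \<xi> \<open>q \<in> closure \<Omega>\<close> \<open>q \<notin> \<Omega>\<close> by (auto simp: frontier)
  with vis \<open>\<xi> \<noteq> q\<close> have "\<exists>U V K. open U \<and> \<xi> \<in> U \<and> open V \<and> q \<in> V \<and> closure U \<inter> closure V = {} \<and>
      compact K \<and> K \<subseteq> \<Omega> \<and> (\<forall>a b \<gamma>. geodesic_segment \<Omega> k a b \<gamma> \<and> \<gamma> a \<in> U \<and> \<gamma> b \<in> V \<longrightarrow>
        \<gamma> ` {a..b} \<inter> K \<noteq> {})"
    unfolding geodesic_visibility_def by simp
  then obtain U V K where UV: "open U" "\<xi> \<in> U" "open V" "q \<in> V" and K: "compact K" "K \<subseteq> \<Omega>"
    and meet: "\<forall>a b \<gamma>. geodesic_segment \<Omega> k a b \<gamma> \<and> \<gamma> a \<in> U \<and> \<gamma> b \<in> V \<longrightarrow> \<gamma> ` {a..b} \<inter> K \<noteq> {}"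
    by (elim exE conjE)
  have "compact (k p ` K)"
    by (rule compact_continuous_image [OF continuous_on_subset [OF continuous_on_kobayashi [OF p] K(2)] K(1)])
  then have "bdd_above (k p ` K)" by (intro bounded_imp_bdd_above compact_imp_bounded)
  then obtain B where "\<forall>s\<in>k p ` K. s \<le> B" unfolding bdd_above_def ..
  then have B: "k p z \<le> B" if "z \<in> K" for z using that by simp
  have "Y \<longlonglongrightarrow> \<xi>"
  proof (rule metric_LIMSEQ_I)
    fix e :: real assume "0 < e"
    then obtain N where N: "inverse (Suc N) < e" using reals_Archimedean by blast
    have "dist (Y n) \<xi> < e" if "N \<le> n" for n
    proof -
      have "inverse (real (Suc n)) \<le> inverse (Suc N)" using that by (intro le_imp_inverse_le) auto
      moreover have "dist (Y n) \<xi> < inverse (Suc n)" using Y [of n] by simp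
      ultimately show ?thesis using N by (meson less_le_trans le_less_trans less_imp_le)
    qed
    then show "\<exists>N. \<forall>n\<ge>N. dist (Y n) \<xi> < e" by blast
  qed
  then have "(Y \<circ> \<rho>) \<longlonglongrightarrow> \<xi>" using \<rho>(1) by (rule LIMSEQ_subseq_LIMSEQ)
  then have "eventually (\<lambda>n. (Y \<circ> \<rho>) n \<in> U) sequentially" using UV(1,2) by (rule topological_tendstoD)
  moreover have "eventually (\<lambda>n. (W \<circ> \<rho>) n \<in> V) sequentially" using \<rho>(2) UV(3,4) by (rule topological_tendstoD)
  moreover have "eventually (\<lambda>n. nat \<lceil>B\<rceil> \<le> n) sequentially" by (rule eventually_ge_at_top)
  ultimately have "eventually (\<lambda>n. False) sequentially"
  proof eventually_elim
    case (elim n)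
    let ?m = "\<rho> n"
    have "geodesic_segment \<Omega> k 0 (c ?m) (G ?m)"
      using G(1) [of ?m] c(1) [of ?m] unfolding geodesic_segment_def by auto
    moreover have "G ?m 0 \<in> U" "G ?m (c ?m) \<in> V" using elim(1,2) G(2) [of ?m] by (auto simp: W_def)
    ultimately have "G ?m ` {0..c ?m} \<inter> K \<noteq> {}" by (intro meet [rule_format] conjI)
    then obtain t where t: "t \<in> {0..c ?m}" "G ?m t \<in> K" by blast
    then have "t \<in> {0..k (Y ?m) (Z ?m)}" using c(1) [of ?m] by auto
    from escape [OF this] have "real n < B" using B [OF t(2)] seq_suble [OF \<rho>(1), of n] by linarith
    moreover have "B \<le> real n" using elim(3) by linarith
    ultimately show ?case by linarith
  qed
  then show False by simp
qed

end


section \<open>Embedding the Euclidean closure\<close>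

theorem theorem1p5:
  fixes \<Omega> :: "(complex ^ 'd) set"
  assumes "open \<Omega>" "connected \<Omega>" "\<Omega> \<noteq> {}"
    and "complete_kobayashi_hyperbolic \<Omega>"
    and "geodesic_visibility \<Omega>"
    and "\<forall>\<xi>\<in>frontier \<Omega>. \<forall>\<gamma> \<sigma>.
           geodesic_ray \<Omega> (kobayashi \<Omega>) \<gamma> \<and> lands_at \<gamma> \<xi> \<and>
           geodesic_ray \<Omega> (kobayashi \<Omega>) \<sigma> \<and> lands_at \<sigma> \<xi> \<longrightarrow>
           strongly_asymptotic (kobayashi \<Omega>) \<gamma> \<sigma>"
  shows "(\<forall>\<xi>\<in>frontier \<Omega>.
            (\<exists>\<gamma>. geodesic_ray \<Omega> (kobayashi \<Omega>) \<gamma> \<and> lands_at \<gamma> \<xi>) \<and>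
            (\<forall>\<gamma>. geodesic_ray \<Omega> (kobayashi \<Omega>) \<gamma> \<and> lands_at \<gamma> \<xi> \<longrightarrow>
                 Psi \<Omega> \<xi> = busemann_class \<Omega> (kobayashi \<Omega>) \<gamma>)) \<and>
         Psi \<Omega> ` closure \<Omega> \<subseteq> topspace (horofunction_compactification \<Omega> (kobayashi \<Omega>)) \<and>
         embedding_map (top_of_set (closure \<Omega>))
           (horofunction_compactification \<Omega> (kobayashi \<Omega>)) (Psi \<Omega>)"
proof -
  have metric: "Metric_space \<Omega> (kobayashi \<Omega>)" and complete: "Metric_space.mcomplete \<Omega> (kobayashi \<Omega>)"
    using assms(4) by (auto simp: complete_kobayashi_hyperbolic_def)
  interpret K: kobayashi_domain \<Omega>
    using metric assms(1,2) by (simp add: kobayashi_domain_def kobayashi_domain_axioms_def)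
  have frontier: "frontier \<Omega> = closure \<Omega> - \<Omega>" using assms(1) by (simp add: frontier_def interior_open)
  interpret V: visibility_space \<Omega> "kobayashi \<Omega>"
  proof
    show "K.mtopology = top_of_set \<Omega>" by (rule K.kobayashi_topology)
    show "compactin K.mtopology (K.mcball x r)" for x r by (rule K.kobayashi_proper [OF complete])
    show "\<exists>\<gamma>. geodesic_segment \<Omega> K.k 0 (K.k x y) \<gamma> \<and> \<gamma> 0 = x \<and> \<gamma> (K.k x y) = y"
      if "x \<in> \<Omega>" "y \<in> \<Omega>" for x y
      by (rule K.proper_length_space_geodesic [OF K.kobayashi_proper [OF complete] K.kobayashi_length_space that])
    show "\<exists>\<delta>>0. \<exists>R. \<forall>y\<in>\<Omega>. \<forall>z\<in>\<Omega>. dist y \<xi> < \<delta> \<longrightarrow> r \<le> dist z \<xi> \<longrightarrow>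
        K.k p y + K.k p z - 2 * R \<le> K.k y z" if "\<xi> \<in> closure \<Omega> - \<Omega>" "0 < r" "p \<in> \<Omega>" for \<xi> r p
      by (rule K.visibility_separation [OF assms(5) complete that])
    show "strongly_asymptotic K.k \<gamma> \<sigma>"
      if "\<xi> \<in> closure \<Omega> - \<Omega>" "geodesic_ray \<Omega> K.k \<gamma>" "lands_at \<gamma> \<xi>" "geodesic_ray \<Omega> K.k \<sigma>" "lands_at \<sigma> \<xi>"
      for \<xi> \<gamma> \<sigma>
      using assms(6) that unfolding frontier by blast
  qed
  obtain p where p: "p \<in> \<Omega>" using assms(3) by blast
  have Psi_boundary: "Psi \<Omega> \<xi> = busemann_class \<Omega> (kobayashi \<Omega>) \<gamma>"
    if \<xi>: "\<xi> \<in> closure \<Omega> - \<Omega>" and \<gamma>: "geodesic_ray \<Omega> (kobayashi \<Omega>) \<gamma>" "lands_at \<gamma> \<xi>" for \<xi> \<gamma>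
  proof -
    let ?\<sigma> = "SOME \<gamma>. geodesic_ray \<Omega> (kobayashi \<Omega>) \<gamma> \<and> lands_at \<gamma> \<xi>"
    have "geodesic_ray \<Omega> (kobayashi \<Omega>) ?\<sigma> \<and> lands_at ?\<sigma> \<xi>"
      by (rule someI [of _ \<gamma>]) (use \<gamma> in simp)
    then have \<sigma>: "geodesic_ray \<Omega> (kobayashi \<Omega>) ?\<sigma>" "lands_at ?\<sigma> \<xi>" by auto
    have "mod_const K.mtopology (\<lambda>x. busemann (kobayashi \<Omega>) ?\<sigma> x p) =
        mod_const K.mtopology (\<lambda>x. busemann (kobayashi \<Omega>) \<gamma> x p)"
      by (rule mod_const_eqI [of _ _ _ 0])
        (simp add: V.busemann_eq_of_common_endpoint [OF \<xi> \<sigma> \<gamma> _ p])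
    then have "busemann_class \<Omega> (kobayashi \<Omega>) ?\<sigma> = busemann_class \<Omega> (kobayashi \<Omega>) \<gamma>"
      using K.busemann_class_basepoint [OF \<sigma>(1) p] K.busemann_class_basepoint [OF \<gamma>(1) p] by simp
    then show ?thesis using \<xi> by (simp add: Psi_def)
  qed
  have Psi_interior: "Psi \<Omega> \<xi> = mod_const K.mtopology (\<lambda>z. kobayashi \<Omega> z \<xi>)" if "\<xi> \<in> \<Omega>" for \<xi>
    using that by (simp add: Psi_def)
  have "\<exists>\<gamma>. geodesic_ray \<Omega> (kobayashi \<Omega>) \<gamma> \<and> lands_at \<gamma> \<xi>" if "\<xi> \<in> closure \<Omega> - \<Omega>" for \<xi>
    using V.ex_landing_ray [OF that p] by blast
  then show ?thesis
    using V.closure_embeds_in_horofunction_compactification [of "Psi \<Omega>", OF Psi_interior Psi_boundary assms(3)]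
      Psi_boundary
    unfolding frontier by blast
qed

end
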